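(* Let $C$ be a commutative unital ring, $R$ a $C$-algebra, $E=(E^0,E^1,\mathbf{s},\mathbf{r})$ a graph, and $t: \overline{CG_E} \to R$ a $C$-linear trace. Then $t$ is minimal if and only if for all $q_1, \dots, q_n \in \mathrm{ClPath}(E)$ and $p_1, \dots, p_m \in \mathrm{ClPath}(E)\setminus E^0$, such that $q_i \not\approx q_j$ and $p_i \not\approx p_j$ for $i \neq j$, the elements $t(q_1), \dots, t(q_n), t(p_1^* ), \dots, t(p_m^* )$ are $C$-linearly independent in $R$.
   Context: Rings are associative but not necessarily unital; $1\in C$ acts as the identity on $C$-algebras. A graph $E=(E^0,E^1,\mathbf{s},\mathbf{r})$ consists of sets $E^0$ (vertices) and $E^1$ (edges) and maps $\mathbf{s},\mathbf{r}:E^1\to E^0$ (source and range). A path is a finite sequence $p=e_1\cdots e_n$ of edges with $\mathbf{r}(e_i)=\mathbf{s}(e_{i+1})$ for $1\le i<n$; $\mathbf{s}(p)=\mathbf{s}(e_1)$, $\mathbf{r}(p)=\mathbf{r}(e_n)$. Vertices $v$ are regarded as paths of length $0$ with $\mathbf{s}(v)=\mathbf{r}(v)=v$. $\mathrm{Path}(E)$ is the set of all paths, and $\mathrm{ClPath}(E)$ the set of closed paths, i.e., those $p\in\mathrm{Path}(E)$ with $\mathbf{s}(p)=\mathbf{r}(p)$ (including vertices). For $p,q\in\mathrm{ClPath}(E)$, $p\approx q$ means that there are $x,y\in\mathrm{Path}(E)$ with $p=xy$ and $yx=q$; this is an equivalence relation. The graph inverse semigroup $G_E$ is the semigroup with zero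 generated by $E^0$, $E^1$ and symbols $\{e^*\mid e\in E^1\}$, subject to, for all $v,w\in E^0$, $e,f\in E^1$: $vw=\delta_{v,w}v$; $\mathbf{s}(e)e=e\mathbf{r}(e)=e$; $\mathbf{r}(e)e^*=e^*\mathbf{s}(e)=e^*$; $e^*f=\delta_{e,f}\mathbf{r}(e)$ ($\delta_{\cdot,\cdot}$ is the Kronecker delta). Set $v^*:=v$ for $v\in E^0$ and $(e_1\cdots e_n)^*:=e_n^*\cdots e_1^*$. $\overline{CG_E}$ is the contracted semigroup ring, i.e., the semigroup ring $CG_E$ with the zero of $G_E$ identified with the zero of the ring; nonzero $g\in G_E$ is identified with $1\cdot g$. A $C$-linear trace $t:A\to R$ between $C$-algebras is a $C$-linear map with $t(xy)=t(yx)$ for all $x,y\in A$; it is minimal if $t(x)=0$ implies $x\in[A,A]$, the additive subgroup of $A$ generated by all commutators $xy-yx$. Elements $x_1,\dots,x_k$ of a $C$-algebra are $C$-linearly independent (as a family) if $c_1x_1+\dots+c_kx_k=0$ with $c_i\in C$ implies all $c_i=0$. *)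

theory Defs
  imports
    "Graph_Theory.Arc_Walk"
    "HOL-Library.Poly_Mapping"
    "HOL-Computational_Algebra.Group_Closure"
begin

section \<open>Paths\<close>

text \<open>
  A graph is a \<^locale>\<open>wf_digraph\<close>, with \<^const>\<open>tail\<close> as source map and \<^const>\<open>head\<close> as range
  map; there are no finiteness assumptions.  A path is a triple consisting of its source, its
  list of edges and its range.  The source and range are determined by the edges unless there are
  none, in which case the path is a vertex \<open>v\<close>, i.e. the triple \<open>(v, [], v)\<close>.
\<close>

type_synonym ('v, 'e) path = "'v \<times> 'e list \<times> 'v"

fun path_source :: "('v, 'e) path \<Rightarrow> 'v" where
  "path_source (u, es, v) = u"

fun path_edges :: "('v, 'e) path \<Rightarrow> 'e list" where
  "path_edges (u, es, v) = es"

fun path_range :: "('v, 'e) path \<Rightarrow> 'v" where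
  "path_range (u, es, v) = v"

definition Path :: "('v, 'e) pre_digraph \<Rightarrow> ('v, 'e) path set" where
  "Path E = {(u, es, v). pre_digraph.awalk E u es v}"

definition ClPath :: "('v, 'e) pre_digraph \<Rightarrow> ('v, 'e) path set" where
  "ClPath E = {p \<in> Path E. path_source p = path_range p}"

definition vertex_paths :: "('v, 'e) pre_digraph \<Rightarrow> ('v, 'e) path set" where
  "vertex_paths E = (\<lambda>v. (v, [], v)) ` verts E"

text \<open>Only meaningful if the range of the first path is the source of the second.\<close>

definition path_comp :: "('v, 'e) path \<Rightarrow> ('v, 'e) path \<Rightarrow> ('v, 'e) path" where
  "path_comp x y = (path_source x, path_edges x @ path_edges y, path_range y)"

definition path_equiv :: "('v, 'e) pre_digraph \<Rightarrow> ('v, 'e) path \<Rightarrow> ('v, 'e) path \<Rightarrow> bool" where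
  "path_equiv E p q \<longleftrightarrow>
    (\<exists>x \<in> Path E. \<exists>y \<in> Path E.
       path_range x = path_source y \<and> p = path_comp x y \<and>
       path_range y = path_source x \<and> path_comp y x = q)"


section \<open>The graph inverse semigroup\<close>

datatype ('v, 'e) gis_gen = Null | Vert 'v | Edge 'e | Ghost 'e

definition gis_gens :: "('v, 'e) pre_digraph \<Rightarrow> ('v, 'e) gis_gen set" where
  "gis_gens E = {Null} \<union> Vert ` verts E \<union> Edge ` arcs E \<union> Ghost ` arcs E"

definition gis_words :: "('v, 'e) pre_digraph \<Rightarrow> ('v, 'e) gis_gen list set" where
  "gis_words E = {w. w \<noteq> [] \<and> set w \<subseteq> gis_gens E}"

text \<open>
  The defining relations.  The presentation as a semigroup with zero is turned into one
  as a semigroup by adding the generator \<^term>\<open>Null\<close>, which stands for the zero, and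
  the two relations making it absorbing.
\<close>

inductive gis_rel ::
    "('v, 'e) pre_digraph \<Rightarrow> ('v, 'e) gis_gen list \<Rightarrow> ('v, 'e) gis_gen list \<Rightarrow> bool"
  for E where
  null_left: "g \<in> gis_gens E \<Longrightarrow> gis_rel E [Null, g] [Null]"
| null_right: "g \<in> gis_gens E \<Longrightarrow> gis_rel E [g, Null] [Null]"
| vert_same: "v \<in> verts E \<Longrightarrow> gis_rel E [Vert v, Vert v] [Vert v]"
| vert_diff: "v \<in> verts E \<Longrightarrow> w \<in> verts E \<Longrightarrow> v \<noteq> w \<Longrightarrow> gis_rel E [Vert v, Vert w] [Null]"
| source_edge: "e \<in> arcs E \<Longrightarrow> gis_rel E [Vert (tail E e), Edge e] [Edge e]"
| edge_range: "e \<in> arcs E \<Longrightarrow> gis_rel E [Edge e, Vert (head E e)] [Edge e]"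
| range_ghost: "e \<in> arcs E \<Longrightarrow> gis_rel E [Vert (head E e), Ghost e] [Ghost e]"
| ghost_source: "e \<in> arcs E \<Longrightarrow> gis_rel E [Ghost e, Vert (tail E e)] [Ghost e]"
| ghost_edge_same: "e \<in> arcs E \<Longrightarrow> gis_rel E [Ghost e, Edge e] [Vert (head E e)]"
| ghost_edge_diff: "e \<in> arcs E \<Longrightarrow> f \<in> arcs E \<Longrightarrow> e \<noteq> f \<Longrightarrow> gis_rel E [Ghost e, Edge f] [Null]"

text \<open>The congruence on the free semigroup \<^const>\<open>gis_words\<close> generated by the defining relations.\<close>

inductive gis_cong ::
    "('v, 'e) pre_digraph \<Rightarrow> ('v, 'e) gis_gen list \<Rightarrow> ('v, 'e) gis_gen list \<Rightarrow> bool"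
  for E where
  rel: "gis_rel E a b \<Longrightarrow> gis_cong E a b"
| refl: "a \<in> gis_words E \<Longrightarrow> gis_cong E a a"
| sym: "gis_cong E a b \<Longrightarrow> gis_cong E b a"
| trans: "gis_cong E a b \<Longrightarrow> gis_cong E b c \<Longrightarrow> gis_cong E a c"
| mult: "gis_cong E a b \<Longrightarrow> gis_cong E c d \<Longrightarrow> gis_cong E (a @ c) (b @ d)"

definition gis_congruence ::
    "('v, 'e) pre_digraph \<Rightarrow> (('v, 'e) gis_gen list \<times> ('v, 'e) gis_gen list) set" where
  "gis_congruence E = {(a, b). gis_cong E a b}"

type_synonym ('v, 'e) gis = "('v, 'e) gis_gen list set"

definition gis_class :: "('v, 'e) pre_digraph \<Rightarrow> ('v, 'e) gis_gen list \<Rightarrow> ('v, 'e) gis" where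
  "gis_class E w = gis_congruence E `` {w}"

definition gis_carrier :: "('v, 'e) pre_digraph \<Rightarrow> ('v, 'e) gis set" where
  "gis_carrier E = gis_words E // gis_congruence E"

definition gis_mult :: "('v, 'e) pre_digraph \<Rightarrow> ('v, 'e) gis \<Rightarrow> ('v, 'e) gis \<Rightarrow> ('v, 'e) gis" where
  "gis_mult E X Y = (\<Union>a\<in>X. \<Union>b\<in>Y. gis_class E (a @ b))"

definition gis_zero :: "('v, 'e) pre_digraph \<Rightarrow> ('v, 'e) gis" where
  "gis_zero E = gis_class E [Null]"

fun path_word :: "('v, 'e) path \<Rightarrow> ('v, 'e) gis_gen list" where
  "path_word (u, es, v) = (if es = [] then [Vert u] else map Edge es)"

fun path_star_word :: "('v, 'e) path \<Rightarrow> ('v, 'e) gis_gen list" where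
  "path_star_word (u, es, v) = (if es = [] then [Vert u] else map Ghost (rev es))"

definition gis_path :: "('v, 'e) pre_digraph \<Rightarrow> ('v, 'e) path \<Rightarrow> ('v, 'e) gis" where
  "gis_path E p = gis_class E (path_word p)"

definition gis_path_star :: "('v, 'e) pre_digraph \<Rightarrow> ('v, 'e) path \<Rightarrow> ('v, 'e) gis" where
  "gis_path_star E p = gis_class E (path_star_word p)"

lemma gis_rel_words:
  assumes "wf_digraph E" "gis_rel E a b"
  shows "a \<in> gis_words E" "b \<in> gis_words E"
  using assms(2,1) by (cases; auto simp: gis_words_def gis_gens_def wf_digraph_def)+

lemma gis_cong_words:
  assumes "wf_digraph E" "gis_cong E a b"
  shows "a \<in> gis_words E \<and> b \<in> gis_words E"
  using assms(2)
proof induction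
  case (rel a b)
  then show ?case using gis_rel_words[OF assms(1)] by blast
qed (auto simp: gis_words_def)

lemma equiv_gis_congruence:
  assumes "wf_digraph E"
  shows "equiv (gis_words E) (gis_congruence E)"
proof (rule equivI)
  show "refl_on (gis_words E) (gis_congruence E)"
    by (auto intro!: refl_onI simp: gis_congruence_def intro: gis_cong.refl)
  show "sym (gis_congruence E)"
    by (auto simp: gis_congruence_def intro!: symI gis_cong.sym)
  show "trans (gis_congruence E)"
    by (auto simp: gis_congruence_def intro!: transI intro: gis_cong.trans)
  show "gis_congruence E \<subseteq> gis_words E \<times> gis_words E"
    using gis_cong_words[OF assms] by (auto simp: gis_congruence_def)
qed

lemma gis_class_eq_iff:
  assumes "wf_digraph E" "a \<in> gis_words E" "b \<in> gis_words E"
  shows "gis_class E a = gis_class E b \<longleftrightarrow> gis_cong E a b"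
  using eq_equiv_class_iff[OF equiv_gis_congruence[OF assms(1)] assms(2,3)]
  by (simp add: gis_class_def gis_congruence_def)

lemma gis_mult_class:
  assumes "wf_digraph E" "a \<in> gis_words E" "b \<in> gis_words E"
  shows "gis_mult E (gis_class E a) (gis_class E b) = gis_class E (a @ b)"
proof -
  have "gis_class E (a' @ b') = gis_class E (a @ b)"
    if "a' \<in> gis_class E a" "b' \<in> gis_class E b" for a' b'
  proof -
    have *: "gis_cong E (a @ b) (a' @ b')"
      using that by (auto simp: gis_class_def gis_congruence_def intro: gis_cong.mult)
    show ?thesis
      using gis_class_eq_iff[OF assms(1)] * gis_cong_words[OF assms(1) *] by metis
  qed
  moreover have "a \<in> gis_class E a" "b \<in> gis_class E b"
    using assms(2,3) by (auto simp: gis_class_def gis_congruence_def intro: gis_cong.refl)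
  ultimately show ?thesis
    unfolding gis_mult_def by blast
qed


section \<open>The contracted semigroup ring\<close>

text \<open>
  Coefficient rings are types of sort \<open>{comm_ring, comm_monoid_mult}\<close>.  This is \<open>comm_ring_1\<close>
  without the axiom \<open>0 \<noteq> 1\<close>, so that the zero ring is included.

  The contracted semigroup ring is the quotient of the semigroup ring by the ideal spanned by
  the zero of the semigroup.  Each coset has exactly one representative in which the zero of
  the semigroup has coefficient \<open>0\<close>; the quotient is represented by these, and passing to the
  representative is \<open>Poly_Mapping.update (gis_zero E) 0\<close>.
\<close>

definition semigroup_ring_mult ::
    "('s \<Rightarrow> 's \<Rightarrow> 's) \<Rightarrow> ('s \<Rightarrow>\<^sub>0 'c) \<Rightarrow> ('s \<Rightarrow>\<^sub>0 'c) \<Rightarrow> ('s \<Rightarrow>\<^sub>0 'c::semiring_0)" where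
  "semigroup_ring_mult m f g =
    (\<Sum>x\<in>Poly_Mapping.keys f. \<Sum>y\<in>Poly_Mapping.keys g.
       Poly_Mapping.single (m x y) (Poly_Mapping.lookup f x * Poly_Mapping.lookup g y))"

definition cgis_carrier ::
    "('v, 'e) pre_digraph \<Rightarrow> (('v, 'e) gis \<Rightarrow>\<^sub>0 'c::{comm_ring, comm_monoid_mult}) set" where
  "cgis_carrier E = {f. Poly_Mapping.keys f \<subseteq> gis_carrier E - {gis_zero E}}"

definition cgis_mult ::
    "('v, 'e) pre_digraph \<Rightarrow> (('v, 'e) gis \<Rightarrow>\<^sub>0 'c) \<Rightarrow> (('v, 'e) gis \<Rightarrow>\<^sub>0 'c)
      \<Rightarrow> (('v, 'e) gis \<Rightarrow>\<^sub>0 'c::{comm_ring, comm_monoid_mult})" where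
  "cgis_mult E f g = Poly_Mapping.update (gis_zero E) 0 (semigroup_ring_mult (gis_mult E) f g)"

definition cgis_scale ::
    "'c \<Rightarrow> (('v, 'e) gis \<Rightarrow>\<^sub>0 'c) \<Rightarrow> (('v, 'e) gis \<Rightarrow>\<^sub>0 'c::{comm_ring, comm_monoid_mult})" where
  "cgis_scale c f = Poly_Mapping.map ((*) c) f"

definition cgis_of ::
    "('v, 'e) pre_digraph \<Rightarrow> ('v, 'e) gis
      \<Rightarrow> (('v, 'e) gis \<Rightarrow>\<^sub>0 'c::{comm_ring, comm_monoid_mult})" where
  "cgis_of E g = Poly_Mapping.update (gis_zero E) 0 (Poly_Mapping.single g 1)"


section \<open>Algebras and traces\<close>

text \<open>Not an extension of \<^locale>\<open>module\<close>, which excludes the zero ring of scalars.\<close>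

locale algebra_over =
  fixes scale :: "'c::{comm_ring, comm_monoid_mult} \<Rightarrow> 'r::ring \<Rightarrow> 'r"
  assumes scale_right_distrib: "scale c (x + y) = scale c x + scale c y"
    and scale_left_distrib: "scale (c + d) x = scale c x + scale d x"
    and scale_scale: "scale c (scale d x) = scale (c * d) x"
    and scale_one: "scale 1 x = x"
    and scale_mult_left: "scale c (x * y) = scale c x * y"
    and scale_mult_right: "scale c (x * y) = x * scale c y"

definition linear_trace ::
    "('v, 'e) pre_digraph \<Rightarrow> ('c \<Rightarrow> 'r \<Rightarrow> 'r)
      \<Rightarrow> ((('v, 'e) gis \<Rightarrow>\<^sub>0 'c::{comm_ring, comm_monoid_mult}) \<Rightarrow> 'r::ring) \<Rightarrow> bool" where
  "linear_trace E scale t \<longleftrightarrow>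
    (\<forall>x\<in>cgis_carrier E. \<forall>y\<in>cgis_carrier E. t (x + y) = t x + t y) \<and>
    (\<forall>c. \<forall>x\<in>cgis_carrier E. t (cgis_scale c x) = scale c (t x)) \<and>
    (\<forall>x\<in>cgis_carrier E. \<forall>y\<in>cgis_carrier E. t (cgis_mult E x y) = t (cgis_mult E y x))"

definition cgis_commutators ::
    "('v, 'e) pre_digraph \<Rightarrow> (('v, 'e) gis \<Rightarrow>\<^sub>0 'c::{comm_ring, comm_monoid_mult}) set" where
  "cgis_commutators E =
    group_closure {cgis_mult E x y - cgis_mult E y x |x y. x \<in> cgis_carrier E \<and> y \<in> cgis_carrier E}"

definition minimal_trace ::
    "('v, 'e) pre_digraph
      \<Rightarrow> ((('v, 'e) gis \<Rightarrow>\<^sub>0 'c::{comm_ring, comm_monoid_mult}) \<Rightarrow> 'r::ring) \<Rightarrow> bool" where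
  "minimal_trace E t \<longleftrightarrow> (\<forall>x\<in>cgis_carrier E. t x = 0 \<longrightarrow> x \<in> cgis_commutators E)"

text \<open>Independence as a family: repeated entries count as distinct members.\<close>

definition lin_indep_family :: "('c::zero \<Rightarrow> 'r::comm_monoid_add \<Rightarrow> 'r) \<Rightarrow> 'r list \<Rightarrow> bool" where
  "lin_indep_family scale xs \<longleftrightarrow>
    (\<forall>c :: nat \<Rightarrow> 'c. (\<Sum>i<length xs. scale (c i) (xs ! i)) = 0 \<longrightarrow> (\<forall>i<length xs. c i = 0))"

definition pairwise_inequivalent :: "('v, 'e) pre_digraph \<Rightarrow> ('v, 'e) path list \<Rightarrow> bool" where
  "pairwise_inequivalent E ps \<longleftrightarrow>
    (\<forall>i<length ps. \<forall>j<length ps. i \<noteq> j \<longrightarrow> \<not> path_equiv E (ps ! i) (ps ! j))"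

lemma lookup_cgis_scale:
  "Poly_Mapping.lookup (cgis_scale c f) x = c * Poly_Mapping.lookup f x"
  by (simp add: cgis_scale_def Poly_Mapping.map.rep_eq when_def)

lemma gis_mult_carrier:
  assumes "wf_digraph E" "X \<in> gis_carrier E" "Y \<in> gis_carrier E"
  shows "gis_mult E X Y \<in> gis_carrier E"
proof -
  obtain a b where "a \<in> gis_words E" "X = gis_class E a" "b \<in> gis_words E" "Y = gis_class E b"
    using assms(2,3) by (auto simp: gis_carrier_def gis_class_def quotient_def)
  then have "gis_mult E X Y = gis_class E (a @ b)" "a @ b \<in> gis_words E"
    by (auto simp: gis_mult_class[OF assms(1)] gis_words_def)
  then show ?thesis
    by (auto simp: gis_carrier_def gis_class_def intro: quotientI)
qed

lemma cgis_mult_carrier: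
  assumes "wf_digraph E" "f \<in> cgis_carrier E" "g \<in> cgis_carrier E"
  shows "cgis_mult E f g \<in> cgis_carrier E"
proof -
  have "Poly_Mapping.keys (semigroup_ring_mult (gis_mult E) f g) \<subseteq> gis_carrier E"
  proof
    fix z assume "z \<in> Poly_Mapping.keys (semigroup_ring_mult (gis_mult E) f g)"
    then have "Poly_Mapping.lookup (semigroup_ring_mult (gis_mult E) f g) z \<noteq> 0"
      by (simp add: in_keys_iff)
    then obtain x y where "x \<in> Poly_Mapping.keys f" "y \<in> Poly_Mapping.keys g" "gis_mult E x y = z"
      unfolding semigroup_ring_mult_def lookup_sum lookup_single when_def
      by (fastforce elim!: sum.not_neutral_contains_not_neutral split: if_splits)
    then show "z \<in> gis_carrier E"
      using assms gis_mult_carrier[OF assms(1)] by (auto simp: cgis_carrier_def)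
  qed
  then show ?thesis
    by (auto simp: cgis_carrier_def cgis_mult_def in_keys_iff Poly_Mapping.update.rep_eq
        split: if_splits)
qed

lemma cgis_of_carrier:
  assumes "g \<in> gis_carrier E"
  shows "cgis_of E g \<in> cgis_carrier E"
  using assms
  by (auto simp: cgis_carrier_def cgis_of_def in_keys_iff Poly_Mapping.update.rep_eq
      lookup_single when_def split: if_splits)

lemma gis_path_carrier:
  assumes "p \<in> Path E"
  shows "gis_path E p \<in> gis_carrier E" "gis_path_star E p \<in> gis_carrier E"
  using assms
  by (cases p; auto simp: gis_path_def gis_path_star_def gis_carrier_def gis_class_def Path_def
      pre_digraph.awalk_def gis_words_def gis_gens_def intro!: quotientI)+

end

theory Submission
  imports Defs
begin

text \<open>
  Every nonzero element of the graph inverse semigroup is \<open>x y\<^sup>*\<close> for unique paths \<open>x\<close>, \<open>y\<close>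
  with the same range; uniqueness comes from letting words act on such pairs.  Since
  \<open>e x y\<^sup>* f\<^sup>*\<close> is conjugate to \<open>f\<^sup>* e x y\<^sup>*\<close>, every element is modulo commutators zero, a closed path
  or the star of a closed path, and equivalent paths are conjugate.  So if the family is
  independent, then \<open>t a = 0\<close> forces the reduced form of \<open>a\<close> modulo commutators to vanish.
  Conversely, being conjugate to a given closed path (or to its star) is invariant under
  \<open>g h \<mapsto> h g\<close>, so summing the coefficients over one such class is a functional that vanishes
  on all commutators, and these functionals read off the coefficients of a linear relation
  between the images under a minimal trace.
\<close>

lemma gis_gens_simps [simp]:
  "Null \<in> gis_gens G"
  "Vert v \<in> gis_gens G \<longleftrightarrow> v \<in> verts G"
  "Edge e \<in> gis_gens G \<longleftrightarrow> e \<in> arcs G"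
  "Ghost e \<in> gis_gens G \<longleftrightarrow> e \<in> arcs G"
  "Edge ` A \<subseteq> gis_gens G \<longleftrightarrow> A \<subseteq> arcs G"
  "Ghost ` A \<subseteq> gis_gens G \<longleftrightarrow> A \<subseteq> arcs G"
  by (auto simp: gis_gens_def)

section \<open>Normal forms\<close>

text \<open>\<^term>\<open>Some (x, v, y)\<close> stands for the element \<open>x v y\<^sup>*\<close>, and \<^term>\<open>None\<close> for zero.\<close>

type_synonym ('v, 'e) nform = "('e list \<times> 'v \<times> 'e list) option"

fun nform_star :: "('v, 'e) nform \<Rightarrow> ('v, 'e) nform" where
  "nform_star None = None"
| "nform_star (Some (x, v, y)) = Some (y, v, x)"

fun star_gen :: "('v, 'e) gis_gen \<Rightarrow> ('v, 'e) gis_gen" where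
  "star_gen Null = Null"
| "star_gen (Vert v) = Vert v"
| "star_gen (Edge e) = Ghost e"
| "star_gen (Ghost e) = Edge e"

lemma nform_star_star [simp]: "nform_star (nform_star n) = n"
  by (induction n rule: nform_star.induct) auto

lemma star_gen_star_gen [simp]: "star_gen (star_gen g) = g"
  by (cases g) auto

section \<open>Generators and words acting on normal forms\<close>

context wf_digraph
begin

text \<open>A normal form stores only the common range \<open>v\<close> of its two paths; this
  recovers the source of either one from its edges.\<close>

fun start :: "'a \<Rightarrow> 'b list \<Rightarrow> 'a" where
  "start v [] = v"
| "start v (e # es) = tail G e"

text \<open>Left multiplication of \<open>x v y\<^sup>*\<close> by a generator. For empty
  \<open>x\<close> a ghost passes to the starred side, since \<open>e\<^sup>* y\<^sup>*\<close> is
  \<open>(y e)\<^sup>*\<close>, and the common range moves from \<open>tail G e\<close> to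
  \<open>head G e\<close>.\<close>

fun left_act :: "('a, 'b) gis_gen \<Rightarrow> ('a, 'b) nform \<Rightarrow> ('a, 'b) nform" where
  "left_act g None = None"
| "left_act Null n = None"
| "left_act (Vert u) (Some (x, v, y)) = (if start v x = u then Some (x, v, y) else None)"
| "left_act (Edge e) (Some (x, v, y)) = (if head G e = start v x then Some (e # x, v, y) else None)"
| "left_act (Ghost e) (Some ([], v, y)) = (if tail G e = v then Some ([], head G e, y @ [e]) else None)"
| "left_act (Ghost e) (Some (f # x, v, y)) = (if e = f then Some (x, v, y) else None)"

text \<open>The star is an involution that reverses products, so multiplying by \<open>g\<close> on
  the right is multiplying the star by the star of \<open>g\<close> on the left.\<close>

definition right_act :: "('a, 'b) gis_gen \<Rightarrow> ('a, 'b) nform \<Rightarrow> ('a, 'b) nform" where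
  "right_act g n = nform_star (left_act (star_gen g) (nform_star n))"

fun nform_ok :: "('a, 'b) nform \<Rightarrow> bool" where
  "nform_ok None = True"
| "nform_ok (Some (x, v, y)) = (awalk (start v x) x v \<and> awalk (start v y) y v)"

text \<open>The vertex fixing a generator from the right (irrelevant for \<^const>\<open>Null\<close>).\<close>

fun gen_range :: "('a, 'b) gis_gen \<Rightarrow> 'a" where
  "gen_range Null = undefined"
| "gen_range (Vert v) = v"
| "gen_range (Edge e) = head G e"
| "gen_range (Ghost e) = tail G e"

text \<open>There is no identity to act on, so the word acts on the vertex that fixes its last
  letter from the right. If that letter is \<open>Null\<close>, the result is \<open>None\<close>
  whatever the seed.\<close>

definition nf :: "('a, 'b) gis_gen list \<Rightarrow> ('a, 'b) nform" where
  "nf w = foldr left_act w (Some ([], gen_range (last w), []))"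

lemma left_act_Null [simp]: "left_act Null n = None"
  by (cases n) auto

lemma nf_append: "b \<noteq> [] \<Longrightarrow> nf (a @ b) = foldr left_act a (nf b)"
  by (simp add: nf_def)

lemma nf_Cons: "b \<noteq> [] \<Longrightarrow> nf (g # b) = left_act g (nf b)"
  by (simp add: nf_def)

lemma awalk_Cons: "awalk u (e # es) v \<longleftrightarrow> u = tail G e \<and> e \<in> arcs G \<and> awalk (head G e) es v"
  by (auto simp: awalk_Cons_iff awalk_def)

lemma awalk_start: "awalk u p v \<Longrightarrow> start v p = u"
  by (cases p) (auto simp: awalk_def)

lemma awalk_startI: "awalk u p v \<Longrightarrow> awalk (start v p) p v"
  by (simp add: awalk_start)

lemma start_snoc [simp]: "start v (p @ [e]) = start (tail G e) p"
  by (cases p) auto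

lemma awalk_snoc:
  "awalk u p (tail G e) \<Longrightarrow> e \<in> arcs G \<Longrightarrow> awalk u (p @ [e]) (head G e)"
  by (rule awalk_appendI) (auto simp: awalk_Cons awalk_Nil_iff)

lemma nform_ok_left_act:
  "nform_ok n \<Longrightarrow> g \<in> gis_gens G \<Longrightarrow> nform_ok (left_act g n)"
  by (induction g n rule: left_act.induct)
    (auto simp: awalk_Cons awalk_Nil_iff awalk_snoc simp del: awalk_append_iff dest: awalk_startI)

lemma nform_ok_foldr_left_act:
  "set w \<subseteq> gis_gens G \<Longrightarrow> nform_ok n \<Longrightarrow> nform_ok (foldr left_act w n)"
  by (induction w) (auto intro: nform_ok_left_act)

lemma nform_ok_star [simp]: "nform_ok (nform_star n) = nform_ok n"
  by (induction n rule: nform_star.induct) auto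

lemma nform_ok_nf: "w \<in> gis_words G \<Longrightarrow> nform_ok (nf w)"
proof (induction w)
  case (Cons g w)
  show ?case
  proof (cases "w = []")
    case True
    show ?thesis
    proof (cases "g = Null")
      case False
      then have "nform_ok (Some ([], gen_range g, []))"
        using Cons.prems by (cases g) (auto simp: gis_words_def awalk_Nil_iff)
      then show ?thesis
        using Cons.prems by (auto simp: True nf_def gis_words_def simp del: nform_ok.simps intro!: nform_ok_left_act)
    qed (simp add: nf_def True)
  next
    case False
    then show ?thesis
      using Cons by (auto simp: nf_Cons gis_words_def intro!: nform_ok_left_act)
  qed
qed (auto simp: gis_words_def)

text \<open>Well-formedness enters in relations such as \<open>r(e) e\<^sup>* = e\<^sup>*\<close>:
  cancelling \<open>e\<close> from the front of \<open>x\<close> has to leave a path that starts at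
  \<open>head G e\<close>.\<close>

lemma gis_rel_left_act:
  assumes "gis_rel G a b" "nform_ok n"
  shows "foldr left_act a n = foldr left_act b n"
proof (cases n)
  case (Some m)
  obtain x v y where "n = Some (x, v, y)" using Some by (cases m) auto
  with assms show ?thesis
    by (cases rule: gis_rel.cases; cases x) (auto simp: awalk_Cons awalk_start)
next
  case None
  have "foldr left_act w None = None" for w :: "('a, 'b) gis_gen list"
    by (induction w) auto
  then show ?thesis by (simp add: None)
qed

lemma gis_rel_nf: "gis_rel G a b \<Longrightarrow> nf a = nf b"
  by (cases rule: gis_rel.cases) (auto simp: nf_def)

text \<open>The statement about arbitrary \<open>n\<close> strengthens the induction: for products,
  \<open>nf (a @ c)\<close> is the action of \<open>a\<close> on \<open>nf c\<close>, so
  \<open>a\<close> and \<open>b\<close> must act alike on every well-formed normal form.\<close>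

lemma gis_cong_nf_aux:
  "gis_cong G a b \<Longrightarrow> nf a = nf b \<and> (\<forall>n. nform_ok n \<longrightarrow> foldr left_act a n = foldr left_act b n)"
proof (induction rule: gis_cong.induct)
  case (rel a b)
  then show ?case by (auto simp: gis_rel_nf gis_rel_left_act)
next
  case (mult a b c d)
  then have "c \<in> gis_words G" "d \<in> gis_words G"
    using gis_cong_words[OF wf_digraph_axioms] by blast+
  with mult.IH show ?case
    by (simp add: nf_append gis_words_def nform_ok_nf nform_ok_foldr_left_act)
qed auto

lemma gis_cong_nf: "gis_cong G a b \<Longrightarrow> nf a = nf b"
  using gis_cong_nf_aux by blast

text \<open>This is associativity, \<open>g (n h) = (g n) h\<close>. It lets \<open>nf_snoc\<close>
  go by induction from the left although it concerns the last letter.\<close>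

lemma left_right_act:
  assumes "nform_ok n"
  shows "left_act g (right_act h n) = right_act h (left_act g n)"
proof (cases n)
  case (Some m)
  obtain x v y where "n = Some (x, v, y)" using Some by (cases m) auto
  with assms show ?thesis
    by (cases g; cases h; cases x; cases y) (auto simp: right_act_def awalk_Cons awalk_start)
qed (simp add: right_act_def)

lemma nf_snoc:
  assumes "w \<in> gis_words G" "g \<in> gis_gens G"
  shows "nf (w @ [g]) = right_act g (nf w)"
  using assms(1)
proof (induction w)
  case (Cons h w)
  show ?case
  proof (cases "w = []")
    case True
    then show ?thesis by (cases g; cases h) (auto simp: nf_def right_act_def)
  next
    case False
    then show ?thesis
      using Cons by (auto simp: nf_Cons gis_words_def left_right_act nform_ok_nf)
  qed
qed (auto simp: gis_words_def)

section \<open>Every word is congruent to the word of its normal form\<close>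

fun nform_word :: "('a, 'b) nform \<Rightarrow> ('a, 'b) gis_gen list" where
  "nform_word None = [Null]"
| "nform_word (Some (x, v, y)) = map Edge x @ Vert v # map Ghost (rev y)"

lemma nform_okD:
  assumes "nform_ok (Some (x, v, y))"
  shows "v \<in> verts G" "set x \<subseteq> arcs G" "set y \<subseteq> arcs G"
  using assms by (auto dest: awalk_last_in_verts)

lemma gis_cong_append_right: "gis_cong G a b \<Longrightarrow> set w \<subseteq> gis_gens G \<Longrightarrow> gis_cong G (a @ w) (b @ w)"
  by (cases "w = []") (auto simp: gis_words_def intro!: gis_cong.mult[OF _ gis_cong.refl])

lemma gis_cong_append_left: "gis_cong G a b \<Longrightarrow> set w \<subseteq> gis_gens G \<Longrightarrow> gis_cong G (w @ a) (w @ b)"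
  by (cases "w = []") (auto simp: gis_words_def intro!: gis_cong.mult[OF gis_cong.refl])

lemma gis_cong_Null_left: "set w \<subseteq> gis_gens G \<Longrightarrow> gis_cong G (Null # w) [Null]"
proof (induction w)
  case (Cons g w)
  have "gis_cong G ([Null, g] @ w) ([Null] @ w)"
    using Cons by (intro gis_cong_append_right gis_cong.rel gis_rel.null_left) auto
  with Cons show ?case by (auto elim: gis_cong.trans)
qed (auto simp: gis_words_def intro: gis_cong.refl)

lemma gis_cong_subst:
  assumes "gis_cong G a b" "gis_cong G (b @ w) c" "set w \<subseteq> gis_gens G"
  shows "gis_cong G (a @ w) c"
  using assms gis_cong_append_right gis_cong.trans by blast

text \<open>Inserting the source of \<open>f\<close> gives \<open>u f = u s(f) f\<close>, a product
  with two different vertices in front.\<close>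

lemma gis_cong_vert_edge_Null:
  assumes "u \<in> verts G" "f \<in> arcs G" "u \<noteq> tail G f"
  shows "gis_cong G [Vert u, Edge f] [Null]"
proof -
  have "gis_cong G ([Vert u] @ [Edge f]) ([Vert u] @ [Vert (tail G f), Edge f])"
    using assms by (intro gis_cong_append_left gis_cong.sym[OF gis_cong.rel] gis_rel.source_edge) auto
  moreover have "gis_cong G ([Vert u, Vert (tail G f)] @ [Edge f]) [Null]"
    using assms by (intro gis_cong_subst[OF gis_cong.rel[OF gis_rel.vert_diff]])
      (auto intro: gis_cong_Null_left)
  ultimately show ?thesis by (auto elim: gis_cong.trans)
qed

text \<open>The chain is \<open>g k = g h k = g 0 = 0\<close>.\<close>

lemma gis_cong_append_Null:
  assumes "gis_cong G [h, k] [Null]" "gis_cong G [g, h] [g]" "g \<in> gis_gens G" "k \<in> gis_gens G"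
  shows "gis_cong G [g, k] [Null]"
proof -
  have "gis_cong G ([g] @ [k]) ([g, h] @ [k])"
    using assms by (intro gis_cong_append_right gis_cong.sym[OF assms(2)]) auto
  moreover have "gis_cong G ([g] @ [h, k]) ([g] @ [Null])"
    using assms by (intro gis_cong_append_left) auto
  moreover have "gis_cong G ([g] @ [Null]) [Null]"
    using assms by (auto intro!: gis_cong.rel gis_rel.null_right)
  ultimately show ?thesis by (auto elim: gis_cong.trans)
qed

text \<open>Only the first letter of the normal word matters: \<open>v\<close> if \<open>x\<close>
  is empty, else the first edge. A mismatch produces \<open>Null\<close>, which absorbs the
  remaining letters.\<close>

lemma gis_cong_nform_word_Vert:
  assumes "nform_ok (Some (x, v, y))" "u \<in> verts G"
  shows "gis_cong G (Vert u # nform_word (Some (x, v, y)))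
    (nform_word (left_act (Vert u) (Some (x, v, y))))"
proof (cases x)
  case Nil
  let ?w = "map Ghost (rev y)"
  have w: "set ?w \<subseteq> gis_gens G" "v \<in> verts G"
    using assms Nil by (auto simp: awalk_def)
  have "gis_cong G ([Vert v, Vert v] @ ?w) (Vert v # ?w)"
    using w by (intro gis_cong_subst[OF gis_cong.rel[OF gis_rel.vert_same]])
      (auto simp: gis_words_def intro!: gis_cong.refl)
  moreover have "gis_cong G ([Vert u, Vert v] @ ?w) [Null]" if "u \<noteq> v"
    using w assms(2) that by (intro gis_cong_subst[OF gis_cong.rel[OF gis_rel.vert_diff]])
      (simp_all add: gis_cong_Null_left)
  ultimately have "gis_cong G ([Vert u, Vert v] @ ?w) (if u = v then [Vert v] @ ?w else [Null])"
    by simp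
  then show ?thesis using Nil by (auto split: if_splits)
next
  case (Cons f x')
  let ?w = "map Edge x' @ Vert v # map Ghost (rev y)"
  have w: "set ?w \<subseteq> gis_gens G" "f \<in> arcs G"
    using nform_okD[OF assms(1)] Cons by auto
  have "gis_cong G ([Vert (tail G f), Edge f] @ ?w) (Edge f # ?w)"
    using w by (intro gis_cong_subst[OF gis_cong.rel[OF gis_rel.source_edge]])
      (auto simp: gis_words_def intro!: gis_cong.refl)
  moreover have "gis_cong G ([Vert u, Edge f] @ ?w) [Null]" if "u \<noteq> tail G f"
    using w assms(2) that by (intro gis_cong_subst[OF gis_cong_vert_edge_Null])
      (simp_all add: gis_cong_Null_left)
  ultimately have "gis_cong G ([Vert u, Edge f] @ ?w) (if u = tail G f then [Edge f] @ ?w else [Null])"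
    by simp
  then show ?thesis using Cons by (auto split: if_splits)
qed

text \<open>If \<open>e\<close> does not fit in front of \<open>x\<close>, inserting
  \<open>r(e)\<close> after \<open>e\<close> reduces the claim to the vertex case, where the product
  is zero.\<close>

lemma gis_cong_nform_word_Edge:
  assumes "nform_ok (Some (x, v, y))" "e \<in> arcs G"
  shows "gis_cong G (Edge e # nform_word (Some (x, v, y)))
    (nform_word (left_act (Edge e) (Some (x, v, y))))"
proof (cases "head G e = start v x")
  case True
  then show ?thesis
    using assms nform_okD[OF assms(1)]
    by (auto simp: gis_words_def simp del: nform_ok.simps intro!: gis_cong.refl)
next
  case False
  have "left_act (Vert (head G e)) (Some (x, v, y)) = None" using False by auto
  then have "gis_cong G (Vert (head G e) # nform_word (Some (x, v, y))) [Null]"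
    using gis_cong_nform_word_Vert[of x v y "head G e"] assms by auto
  then have "gis_cong G ([Edge e] @ Vert (head G e) # nform_word (Some (x, v, y))) ([Edge e] @ [Null])"
    using assms by (intro gis_cong_append_left) auto
  moreover have "gis_cong G ([Edge e] @ [Null]) [Null]"
    using assms by (auto intro!: gis_cong.rel gis_rel.null_right)
  moreover have "gis_cong G ([Edge e] @ nform_word (Some (x, v, y)))
      ([Edge e, Vert (head G e)] @ nform_word (Some (x, v, y)))"
    using assms by (intro gis_cong_append_right gis_cong.sym[OF gis_cong.rel] gis_rel.edge_range)
      (use nform_okD[OF assms(1)] in auto)
  ultimately show ?thesis using False by (auto elim: gis_cong.trans)
qed

text \<open>For empty \<open>x\<close>, \<open>e\<^sup>* v\<close> is compared with
  \<open>e\<^sup>* s(e)\<close>: either the vertices differ and the product is zero, or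
  \<open>v\<close> is traded for \<open>r(e)\<close> on the left. Otherwise the first edge of
  \<open>x\<close> is cancelled or annihilated.\<close>

lemma gis_cong_nform_word_Ghost:
  assumes "nform_ok (Some (x, v, y))" "e \<in> arcs G"
  shows "gis_cong G (Ghost e # nform_word (Some (x, v, y)))
    (nform_word (left_act (Ghost e) (Some (x, v, y))))"
proof (cases x)
  case Nil
  let ?w = "map Ghost (rev y)"
  have w: "set ?w \<subseteq> gis_gens G" "v \<in> verts G"
    using assms Nil by (auto simp: awalk_def)
  show ?thesis
  proof (cases "v = tail G e")
    case True
    have "gis_cong G [Ghost e, Vert (tail G e)] [Vert (head G e), Ghost e]"
      using assms(2) by (meson gis_cong.intros gis_rel.intros)
    then have "gis_cong G ([Ghost e, Vert (tail G e)] @ ?w) ([Vert (head G e), Ghost e] @ ?w)"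
      using w by (intro gis_cong_append_right) auto
    then show ?thesis using Nil True by auto
  next
    case False
    have "gis_cong G [Ghost e, Vert v] [Null]"
    proof (rule gis_cong_append_Null)
      show "gis_cong G [Vert (tail G e), Vert v] [Null]"
        using assms w False by (intro gis_cong.rel gis_rel.vert_diff) auto
      show "gis_cong G [Ghost e, Vert (tail G e)] [Ghost e]"
        using assms by (intro gis_cong.rel gis_rel.ghost_source) auto
    qed (use assms w in auto)
    then have "gis_cong G ([Ghost e, Vert v] @ ?w) [Null]"
      using w by (elim gis_cong_subst) (simp_all add: gis_cong_Null_left)
    then show ?thesis using Nil False by auto
  qed
next
  case (Cons f x')
  let ?w = "map Edge x' @ Vert v # map Ghost (rev y)"
  have w: "set ?w \<subseteq> gis_gens G" "f \<in> arcs G"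
    using nform_okD[OF assms(1)] Cons by auto
  show ?thesis
  proof (cases "e = f")
    case True
    have "nform_ok (Some (x', v, y))" "start v x' = head G f" "head G f \<in> verts G"
      using assms Cons w(2) by (auto simp: awalk_Cons awalk_start)
    \<comment> \<open>Cancelling \<open>e\<^sup>* e\<close> leaves \<open>r(e)\<close> in front,
      which the rest of the word absorbs.\<close>
    then have "gis_cong G (Vert (head G f) # ?w) ?w"
      using gis_cong_nform_word_Vert[of x' v y "head G f"] by simp
    then have "gis_cong G ([Ghost f, Edge f] @ ?w) ?w"
      using w by (intro gis_cong_subst[OF gis_cong.rel[OF gis_rel.ghost_edge_same]]) auto
    then show ?thesis using True Cons by auto
  next
    case False
    have "gis_cong G ([Ghost e, Edge f] @ ?w) [Null]"
      using w assms False by (intro gis_cong_subst[OF gis_cong.rel[OF gis_rel.ghost_edge_diff]])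
       (simp_all add: gis_cong_Null_left)
    then show ?thesis using False Cons by auto
  qed
qed

lemma nform_word_gens: "nform_ok n \<Longrightarrow> set (nform_word n) \<subseteq> gis_gens G"
  by (induction n rule: nform_word.induct)
    (auto simp: subset_iff simp del: nform_ok.simps dest: nform_okD)

lemma gis_cong_nform_word:
  assumes "nform_ok n" "g \<in> gis_gens G"
  shows "gis_cong G (g # nform_word n) (nform_word (left_act g n))"
proof (cases n)
  case None
  then show ?thesis using assms by (auto intro!: gis_cong.rel gis_rel.null_right)
next
  case (Some m)
  obtain x v y where n: "n = Some (x, v, y)" using Some by (cases m) auto
  show ?thesis
  proof (cases g)
    case Null
    then show ?thesis using assms nform_word_gens[of n] by (auto intro!: gis_cong_Null_left)
  qed (use assms n gis_cong_nform_word_Vert gis_cong_nform_word_Edge gis_cong_nform_word_Ghost in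
      \<open>auto simp del: nform_word.simps left_act.simps\<close>)
qed

text \<open>The converse of \<open>gis_cong_nf\<close>: together they show that the normal form
  determines the class of a word.\<close>

lemma gis_cong_nf_word: "w \<in> gis_words G \<Longrightarrow> gis_cong G w (nform_word (nf w))"
proof (induction w)
  case (Cons g w)
  then have g: "g \<in> gis_gens G" by (auto simp: gis_words_def)
  show ?case
  proof (cases "w = []")
    case False
    with Cons have w: "w \<in> gis_words G" by (auto simp: gis_words_def)
    have "gis_cong G ([g] @ w) ([g] @ nform_word (nf w))"
      using g Cons.IH[OF w] by (intro gis_cong_append_left) auto
    moreover have "gis_cong G (g # nform_word (nf w)) (nform_word (left_act g (nf w)))"
      using w g by (intro gis_cong_nform_word nform_ok_nf)
    ultimately show ?thesis using False by (auto simp: nf_Cons elim: gis_cong.trans)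
  next
    case True
    show ?thesis
    proof (cases "g = Null")
      case False
      let ?n = "Some ([], gen_range g, [])"
      have ok: "nform_ok ?n"
        using False g by (cases g) (auto simp: awalk_Nil_iff)
      \<comment> \<open>The seed of \<open>nf\<close> was chosen so that multiplying by it on the
        right leaves \<open>g\<close> unchanged.\<close>
      have "gis_cong G [g] (g # nform_word ?n)"
        using False g by (cases g) (auto intro!: gis_cong.sym[OF gis_cong.rel] intro: gis_rel.intros)
      moreover have "gis_cong G (g # nform_word ?n) (nform_word (left_act g ?n))"
        using gis_cong_nform_word[OF ok g] .
      ultimately show ?thesis using True by (auto simp: nf_def elim: gis_cong.trans)
    qed (use True in \<open>auto simp: nf_def gis_words_def intro!: gis_cong.refl\<close>)
  qed
qed (auto simp: gis_words_def)

section \<open>Conjugation\<close>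

text \<open>Symmetry needs no rule of its own, since both generating rules are symmetric.\<close>

inductive conjugate :: "('a, 'b) gis_gen list \<Rightarrow> ('a, 'b) gis_gen list \<Rightarrow> bool" where
  of_cong: "gis_cong G a b \<Longrightarrow> conjugate a b"
| swap: "a \<in> gis_words G \<Longrightarrow> b \<in> gis_words G \<Longrightarrow> conjugate (a @ b) (b @ a)"
| conj_trans: "conjugate a b \<Longrightarrow> conjugate b c \<Longrightarrow> conjugate a c"

lemma nform_word_snoc_conjugate:
  assumes "nform_ok n" "g \<in> gis_gens G"
  shows "conjugate (nform_word n @ [g]) (nform_word (left_act g n))"
proof -
  have "nform_word n \<in> gis_words G"
    using assms nform_word_gens by (cases n rule: nform_word.cases) (auto simp: gis_words_def)
  then have "conjugate (nform_word n @ [g]) ([g] @ nform_word n)"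
    using assms by (intro conjugate.swap) (auto simp: gis_words_def)
  moreover have "conjugate (g # nform_word n) (nform_word (left_act g n))"
    using assms by (intro conjugate.of_cong gis_cong_nform_word)
  ultimately show ?thesis by (auto elim: conjugate.conj_trans)
qed

text \<open>Induction on \<open>x\<close>. The last letter of \<open>y\<^sup>*\<close> is the ghost
  of the first edge of \<open>y\<close>; moved to the front it cancels the first edge of
  \<open>x\<close> or yields zero. Once \<open>x\<close> or \<open>y\<close> is empty, moving the
  final vertex to the front gives zero unless the remaining path is closed.\<close>

lemma nform_word_conjugate:
  assumes "nform_ok (Some (x, v, y))"
  shows "conjugate (nform_word (Some (x, v, y))) [Null] \<or>
    (\<exists>p \<in> ClPath G. conjugate (nform_word (Some (x, v, y))) (path_word p)) \<or>
    (\<exists>p \<in> ClPath G - vertex_paths G. conjugate (nform_word (Some (x, v, y))) (path_star_word p))"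
  using assms
proof (induction x arbitrary: y)
  case Nil
  let ?n = "Some ([], v, y)"
  show ?case
  proof (cases "y = []")
    case True
    have "(v, [], v) \<in> ClPath G"
      using Nil True by (auto simp: ClPath_def Path_def)
    moreover have "conjugate (nform_word ?n) (path_word (v, [], v))"
      using Nil True by (auto simp: awalk_Nil_iff gis_words_def intro!: conjugate.of_cong gis_cong.refl)
    ultimately show ?thesis by blast
  next
    case False
    then obtain e y' where y: "y = e # y'" by (cases y) auto
    have e: "e \<in> arcs G" "v \<in> verts G" "set y' \<subseteq> arcs G" using Nil y by (auto simp: awalk_Cons awalk_def)
    have "gis_cong G ((Vert v # map Ghost (rev y')) @ [Ghost e])
       ((Vert v # map Ghost (rev y')) @ [Ghost e, Vert (tail G e)])"
      using e by (intro gis_cong_append_left gis_cong.sym[OF gis_cong.rel] gis_rel.ghost_source) auto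
    then have 1: "conjugate (nform_word ?n) (nform_word ?n @ [Vert (tail G e)])"
      using y by (auto intro: conjugate.of_cong)
    have 2: "conjugate (nform_word ?n) (nform_word (left_act (Vert (tail G e)) ?n))"
      using conjugate.conj_trans[OF 1 nform_word_snoc_conjugate[OF Nil]] e by auto
    show ?thesis
    proof (cases "v = tail G e")
      case True
      have "(v, y, v) \<in> ClPath G - vertex_paths G"
        using Nil True y by (auto simp: ClPath_def Path_def vertex_paths_def)
      \<comment> \<open>\<open>path_star_word\<close> has no vertex letter for a path with edges, so
        the vertex of the normal word is absorbed by the ghost of the last edge of
        \<open>y\<close>.\<close>
      moreover have "gis_cong G ([Vert v] @ map Ghost (rev y)) (map Ghost (rev y))"
      proof -
        obtain f z where z: "rev y = f # z" using False by (cases "rev y") auto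
        then have f: "y = rev z @ [f]" by (simp add: rev_eq_Cons_iff)
        then have "f \<in> arcs G" "v = head G f" "set z \<subseteq> arcs G"
          using Nil by (auto simp: awalk_append_iff awalk_Cons awalk_Nil_iff awalk_def)
        then have "gis_cong G ([Vert v, Ghost f] @ map Ghost z) ([Ghost f] @ map Ghost z)"
          using e by (intro gis_cong_append_right) (auto intro!: gis_cong.rel gis_rel.range_ghost)
        then show ?thesis using z by auto
      qed
      ultimately show ?thesis
        using False by (intro disjI2 bexI[of _ "(v, y, v)"]) (auto intro: conjugate.of_cong)
    qed (use 2 in auto)
  qed
next
  case (Cons e x)
  let ?n = "Some (e # x, v, y)"
  have e: "e \<in> arcs G" "v \<in> verts G" "set x \<subseteq> arcs G" "set y \<subseteq> arcs G"
    using nform_okD[OF Cons.prems] by auto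
  show ?case
  proof (cases y)
    case Nil
    have n: "nform_word ?n \<in> gis_words G"
      using e Nil by (auto simp: gis_words_def)
    have "gis_cong G ([Vert v] @ []) ([Vert v] @ [Vert v])"
      using e by (auto intro!: gis_cong.sym[OF gis_cong.rel] gis_rel.vert_same)
    then have "gis_cong G (map Edge (e # x) @ [Vert v]) (map Edge (e # x) @ [Vert v, Vert v])"
      using e by (intro gis_cong_append_left) auto
    then have 1: "conjugate (nform_word ?n) (nform_word ?n @ [Vert v])"
      using Nil by (auto intro: conjugate.of_cong)
    have 2: "conjugate (nform_word ?n) (nform_word (left_act (Vert v) ?n))"
      using conjugate.conj_trans[OF 1 nform_word_snoc_conjugate[OF Cons.prems]] e by auto
    show ?thesis
    proof (cases "tail G e = v")
      case True
      have "(v, e # x, v) \<in> ClPath G"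
        using Cons.prems True by (auto simp: ClPath_def Path_def)
      \<comment> \<open>Likewise the final vertex is absorbed by the last edge, to reach
        \<open>path_word\<close>.\<close>
      moreover have "gis_cong G (map Edge (e # x) @ [Vert v]) (map Edge (e # x))"
      proof -
        obtain f z where z: "e # x = z @ [f]" by (cases "e # x" rule: rev_cases) auto
        moreover have "awalk (tail G e) (e # x) v" using Cons.prems by simp
        ultimately have "awalk (tail G e) (z @ [f]) v" by simp
        then have "f \<in> arcs G" "v = head G f" "set z \<subseteq> arcs G"
          by (auto simp: awalk_append_iff awalk_Cons awalk_Nil_iff awalk_def)
        then have "gis_cong G (map Edge z @ [Edge f, Vert v]) (map Edge z @ [Edge f])"
          using e by (intro gis_cong_append_left) (auto intro!: gis_cong.rel gis_rel.edge_range)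
        then show ?thesis unfolding z by auto
      qed
      ultimately show ?thesis
        using Nil by (intro disjI2 disjI1 bexI[of _ "(v, e # x, v)"]) (auto intro: conjugate.of_cong)
    qed (use 2 in auto)
  next
    case (Cons f y')
    let ?m = "Some (e # x, v, y')"
    have ok: "nform_ok ?m" using Cons.prems Cons by (auto simp: awalk_Cons awalk_start)
    have "conjugate (nform_word ?m @ [Ghost f]) (nform_word (left_act (Ghost f) ?m))"
      using Cons e by (intro nform_word_snoc_conjugate[OF ok]) auto
    then have *: "conjugate (nform_word ?n) (nform_word (left_act (Ghost f) ?m))"
      using Cons by simp
    show ?thesis
    proof (cases "e = f")
      case True
      then have "nform_ok (Some (x, v, y'))"
        using ok by (auto simp: awalk_Cons awalk_start)
      moreover have "conjugate (nform_word ?n) w" if "conjugate (nform_word (Some (x, v, y'))) w" for w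
        using conjugate.conj_trans[OF * ] that True by simp
      ultimately show ?thesis using Cons.IH by blast
    qed (use * in auto)
  qed
qed

lemma gis_word_conjugate:
  assumes "w \<in> gis_words G"
  shows "conjugate w [Null] \<or> (\<exists>p \<in> ClPath G. conjugate w (path_word p)) \<or>
    (\<exists>p \<in> ClPath G - vertex_paths G. conjugate w (path_star_word p))"
proof (cases "nf w")
  case None
  then show ?thesis using gis_cong_nf_word[OF assms] by (auto intro: conjugate.of_cong)
next
  case (Some m)
  obtain x v y where "nf w = Some (x, v, y)" using Some by (cases m) auto
  then show ?thesis
    using gis_cong_nf_word[OF assms] nform_ok_nf[OF assms] nform_word_conjugate[of x v y]
    by (metis conjugate.of_cong conjugate.conj_trans)
qed

section \<open>Rotation of closed paths\<close>

text \<open>Phrased by rotations of edge lists, transitivity becomes addition of rotation amounts.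
  The last clause is there because an empty edge list does not reveal its vertex; a nonempty one
  determines the base point through its first edge.\<close>

lemma path_equiv_rotate_iff:
  "path_equiv G p q \<longleftrightarrow> p \<in> ClPath G \<and> q \<in> ClPath G \<and>
    (\<exists>n. path_edges q = rotate n (path_edges p)) \<and> (path_edges p = [] \<longrightarrow> p = q)"
proof
  assume "path_equiv G p q"
  then obtain x y where xy: "x \<in> Path G" "y \<in> Path G" "path_range x = path_source y"
    "p = path_comp x y" "path_range y = path_source x" "q = path_comp y x"
    unfolding path_equiv_def by metis
  obtain u es v where x: "x = (u, es, v)" by (cases x) auto
  obtain fs where y: "y = (v, fs, u)" using xy x by (cases y) auto
  have "rotate (length es) (es @ fs) = fs @ es" by (simp add: rotate_append)
  with xy x y show "p \<in> ClPath G \<and> q \<in> ClPath G \<and>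
    (\<exists>n. path_edges q = rotate n (path_edges p)) \<and> (path_edges p = [] \<longrightarrow> p = q)"
    by (auto simp: Path_def ClPath_def path_comp_def awalk_Nil_iff intro: awalk_appendI intro!: exI[of _ "length es"])
next
  assume *: "p \<in> ClPath G \<and> q \<in> ClPath G \<and>
    (\<exists>n. path_edges q = rotate n (path_edges p)) \<and> (path_edges p = [] \<longrightarrow> p = q)"
  then obtain u es where p: "p = (u, es, u)" "awalk u es u"
    by (cases p) (auto simp: ClPath_def Path_def)
  from * obtain w fs where q: "q = (w, fs, w)" "awalk w fs w"
    by (cases q) (auto simp: ClPath_def Path_def)
  show "path_equiv G p q"
  proof (cases "es = []")
    case True
    then show ?thesis
      using * p q unfolding path_equiv_def
      by (intro bexI[of _ p]) (auto simp: ClPath_def path_comp_def)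
  next
    case False
    from * p q obtain n where "fs = rotate n es" by auto
    then obtain k where fs: "fs = drop k es @ take k es" by (auto simp: rotate_drop_take)
    have "awalk u (take k es @ drop k es) u" using p by simp
    \<comment> \<open>The vertex at which the rotation cuts the closed path, which becomes the base
      point of the rotated one.\<close>
    then obtain m where m: "awalk u (take k es) m" "awalk m (drop k es) u"
      by (auto simp only: awalk_append_iff)
    then have "awalk m fs m" unfolding fs by (rule awalk_appendI[rotated])
    moreover have "fs \<noteq> []" using False unfolding fs by (metis append_is_Nil_conv append_take_drop_id)
    ultimately have "m = w" using q(2) by (cases fs) (auto simp: awalk_Cons)
    with m p q fs show ?thesis
      unfolding path_equiv_def
      by (intro bexI[of _ "(u, take k es, m)"] bexI[of _ "(m, drop k es, u)"])
        (auto simp: Path_def path_comp_def)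
  qed
qed

lemma path_equiv_sym: "path_equiv G p q \<Longrightarrow> path_equiv G q p"
  unfolding path_equiv_def by metis

lemma path_equiv_trans: "path_equiv G p q \<Longrightarrow> path_equiv G q r \<Longrightarrow> path_equiv G p r"
  by (auto simp: path_equiv_rotate_iff rotate_rotate)

lemma path_equiv_refl: "p \<in> ClPath G \<Longrightarrow> path_equiv G p p"
  by (auto simp: path_equiv_rotate_iff intro!: exI[of _ 0])

text \<open>Both \<open>e x\<close> and \<open>x e\<close> are closed exactly when \<open>e\<close>
  is an edge and \<open>x\<close> runs from its range to its source, and they are rotations of each
  other. A closed path beginning with \<open>e\<close> can only be based at
  \<open>tail G e\<close>.\<close>

lemma path_equiv_rotate1:
  "path_equiv G q (v, e # x, v) \<longleftrightarrow> v = tail G e \<and> path_equiv G q (head G e, x @ [e], head G e)"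
proof -
  have *: "path_equiv G (tail G e, e # x, tail G e) (head G e, x @ [e], head G e)"
    if "(tail G e, e # x, tail G e) \<in> ClPath G \<or> (head G e, x @ [e], head G e) \<in> ClPath G"
  proof -
    have "awalk (head G e) x (tail G e)" "e \<in> arcs G"
      using that by (auto simp: ClPath_def Path_def awalk_Cons awalk_Nil_iff awalk_append_iff)
    then show ?thesis
      by (auto simp: path_equiv_rotate_iff ClPath_def Path_def awalk_Cons awalk_Nil_iff
        intro: awalk_snoc intro!: exI[of _ 1])
  qed
  have cl: "p \<in> ClPath G" if "path_equiv G q p" for p
    using that by (simp add: path_equiv_rotate_iff)
  have v: "v = tail G e" if "(v, e # x, v) \<in> ClPath G"
    using that by (auto simp: ClPath_def Path_def awalk_Cons)
  show ?thesis
  proof (intro iffI conjI)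
    assume L: "path_equiv G q (v, e # x, v)"
    then show v': "v = tail G e" using cl v by blast
    show "path_equiv G q (head G e, x @ [e], head G e)"
      using path_equiv_trans[OF L] * cl[OF L] v' by simp
  next
    assume R: "v = tail G e \<and> path_equiv G q (head G e, x @ [e], head G e)"
    then show "path_equiv G q (v, e # x, v)"
      using path_equiv_trans[OF _ path_equiv_sym[OF *]] cl by blast
  qed
qed

section \<open>Conjugation invariants read off from normal forms\<close>

text \<open>Note that \<open>y z y\<^sup>*\<close> is conjugate to \<open>y\<^sup>* y z = z\<close>.\<close>

definition reduces_to :: "('a, 'b) path \<Rightarrow> ('a, 'b) nform \<Rightarrow> bool" where
  "reduces_to q n \<longleftrightarrow> (\<exists>v y z. n = Some (y @ z, v, y) \<and> path_equiv G q (v, z, v))"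

lemma reduces_to_None [simp]: "\<not> reduces_to q None"
  by (simp add: reduces_to_def)

lemma reduces_to_Some:
  "reduces_to q (Some (x, v, y)) \<longleftrightarrow> (\<exists>z. x = y @ z \<and> path_equiv G q (v, z, v))"
  by (auto simp: reduces_to_def)

lemma path_equiv_start:
  "path_equiv G q (v, z, v) \<Longrightarrow> start v z = v"
  by (auto simp: path_equiv_rotate_iff ClPath_def Path_def intro: awalk_start)

lemma start_append: "awalk (start v y) y v \<Longrightarrow> start v z = v \<Longrightarrow> start v (y @ z) = start v y"
  by (cases y) auto

text \<open>In \<open>y z y\<^sup>*\<close> with \<open>z\<close> closed, both ends are the source
  of \<open>y\<close>. This makes the source conditions of left and right multiplication
  agree.\<close>

lemma reduces_to_start:
  "nform_ok (Some (x, v, y)) \<Longrightarrow> reduces_to q (Some (x, v, y)) \<Longrightarrow> start v x = start v y"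
  by (auto simp: reduces_to_Some start_append dest!: path_equiv_start)

text \<open>Rotation is needed only for an edge \<open>e\<close> and empty \<open>y\<close>, where
  the products are \<open>e x\<close> and \<open>x e\<close>. If \<open>y\<close> begins with an
  edge \<open>f\<close>, both sides require \<open>e = f\<close> and then concern the same smaller
  pair; a ghost against nonempty \<open>x\<close> is similar, and against empty \<open>x\<close>
  neither side can hold.\<close>

lemma reduces_to_left_right_act:
  assumes "nform_ok n"
  shows "reduces_to q (left_act g n) = reduces_to q (right_act g n)"
proof (cases n)
  case (Some m)
  then obtain x v y where n: "n = Some (x, v, y)" by (cases m) auto
  show ?thesis
  proof (cases g)
    case (Vert u)
    then show ?thesis using n assms reduces_to_start[of x v y q] by (auto simp: right_act_def)
  next
    case (Edge e)
    show ?thesis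
    proof (cases y)
      case Nil
      have "path_equiv G q (head G e, x @ [e], head G e) \<Longrightarrow> tail G e = v \<Longrightarrow> head G e = start v x"
        using path_equiv_start[of q "head G e" "x @ [e]"] by auto
      moreover have "reduces_to q (left_act g n) \<longleftrightarrow> head G e = start v x \<and> path_equiv G q (v, e # x, v)"
        using n Edge Nil by (simp add: reduces_to_Some)
      moreover have "reduces_to q (right_act g n) \<longleftrightarrow>
          tail G e = v \<and> path_equiv G q (head G e, x @ [e], head G e)"
        using n Edge Nil by (simp add: right_act_def reduces_to_Some)
      ultimately show ?thesis using path_equiv_rotate1[of q v e x] by blast
    next
      case (Cons f y')
      have "nform_ok (Some (x, v, y'))" "head G f = start v y'"
        using assms Cons n by (auto simp: awalk_Cons awalk_start)
      then have "reduces_to q (Some (x, v, y')) \<Longrightarrow> head G f = start v x"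
        using reduces_to_start[of x v y' q] by simp
      then show ?thesis using n Edge Cons by (auto simp: right_act_def reduces_to_Some)
    qed
  next
    case (Ghost e)
    show ?thesis
    proof (cases x)
      case Nil
      then show ?thesis using n Ghost by (auto simp: right_act_def reduces_to_Some)
    next
      case (Cons f x')
      have "nform_ok (Some (x', v, y))" "head G f = start v x'"
        using assms Cons n by (auto simp: awalk_Cons awalk_start)
      then have "reduces_to q (Some (x', v, y)) \<Longrightarrow> head G f = start v y"
        using reduces_to_start[of x' v y q] by simp
      then show ?thesis using n Ghost Cons by (auto simp: right_act_def reduces_to_Some)
    qed
  qed (auto simp: right_act_def)
qed (simp add: right_act_def)

text \<open>The star exchanges the left and right actions, so this is the previous lemma for the
  stars of \<open>n\<close> and \<open>g\<close>.\<close>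

lemma reduces_to_star_left_right_act:
  assumes "nform_ok n"
  shows "reduces_to q (nform_star (left_act g n)) = reduces_to q (nform_star (right_act g n))"
  using reduces_to_left_right_act[of "nform_star n" q "star_gen g"] assms
  unfolding right_act_def by simp

text \<open>Rotating a word one generator at a time reduces invariance under \<open>a b \<mapsto> b a\<close> to the
  case of a generator \<open>a\<close>.\<close>

lemma nf_swap_invariant:
  assumes inv: "\<And>g n. g \<in> gis_gens G \<Longrightarrow> nform_ok n \<Longrightarrow> P (left_act g n) = P (right_act g n)"
    and "a \<in> gis_words G" "b \<in> gis_words G"
  shows "P (nf (a @ b)) = P (nf (b @ a))"
proof -
  have "set a \<subseteq> gis_gens G" using assms(2) by (simp add: gis_words_def)
  then show ?thesis using assms(3)
  proof (induction a arbitrary: b)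
    case (Cons g a)
    then have ab: "a @ b \<in> gis_words G" "b @ [g] \<in> gis_words G" by (auto simp: gis_words_def)
    have "P (nf (g # a @ b)) = P (nf ((a @ b) @ [g]))"
      using Cons.prems ab inv[of g "nf (a @ b)"]
      by (subst nf_snoc) (auto simp: nf_Cons gis_words_def nform_ok_nf)
    also have "\<dots> = P (nf (b @ g # a))"
      using Cons.IH[OF _ ab(2)] Cons.prems by auto
    finally show ?case by simp
  qed auto
qed

lemma nf_path_word:
  assumes "(u, es, v) \<in> Path G"
  shows "nf (path_word (u, es, v)) = Some (es, v, [])"
proof -
  have "nf (map Edge es) = Some (es, v, [])" if "es \<noteq> []" "awalk u es v" for u
    using that
  proof (induction es arbitrary: u)
    case (Cons e es)
    then show ?case
      by (cases "es = []") (auto simp: nf_Cons awalk_Cons awalk_start awalk_Nil_iff nf_def[of "[_]"])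
  qed simp
  with assms show ?thesis by (auto simp: Path_def awalk_Nil_iff nf_def[of "[_]"])
qed

lemma nf_path_star_word:
  assumes "(u, es, v) \<in> Path G"
  shows "nf (path_star_word (u, es, v)) = Some ([], v, es)"
proof -
  have "nf (map Ghost (rev es)) = Some ([], v, es)" if "es \<noteq> []" "awalk u es v" for v
    using that
  proof (induction es arbitrary: v rule: rev_induct)
    case (snoc e es)
    then show ?case
      by (cases "es = []") (auto simp: nf_Cons awalk_Cons awalk_append_iff awalk_Nil_iff nf_def[of "[_]"])
  qed simp
  with assms show ?thesis by (auto simp: Path_def awalk_Nil_iff nf_def[of "[_]"])
qed

end

section \<open>Sums of coefficients\<close>

definition coeff_sum :: "'s set \<Rightarrow> ('s \<Rightarrow>\<^sub>0 'c::comm_monoid_add) \<Rightarrow> 'c" where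
  "coeff_sum S f = (\<Sum>g\<in>Poly_Mapping.keys f. Poly_Mapping.lookup f g when g \<in> S)"

lemma coeff_sum_superset:
  assumes "finite B" "Poly_Mapping.keys f \<subseteq> B"
  shows "coeff_sum S f = (\<Sum>g\<in>B. Poly_Mapping.lookup f g when g \<in> S)"
  unfolding coeff_sum_def using assms
  by (intro sum.mono_neutral_left) (auto simp: in_keys_iff)

lemma coeff_sum_zero [simp]: "coeff_sum S 0 = 0"
  by (simp add: coeff_sum_def)

lemma coeff_sum_add: "coeff_sum S (f + g) = coeff_sum S f + coeff_sum S g"
proof -
  let ?B = "Poly_Mapping.keys f \<union> Poly_Mapping.keys g"
  have "coeff_sum S h = (\<Sum>x\<in>?B. Poly_Mapping.lookup h x when x \<in> S)" if "h \<in> {f, g, f + g}" for h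
    using that keys_add[of f g] by (intro coeff_sum_superset) auto
  then show ?thesis by (simp add: lookup_add when_add_distrib sum.distrib)
qed

lemma coeff_sum_diff:
  fixes f g :: "'s \<Rightarrow>\<^sub>0 'c::ab_group_add"
  shows "coeff_sum S (f - g) = coeff_sum S f - coeff_sum S g"
  using coeff_sum_add[of S "f - g" g] by (simp add: algebra_simps)

lemma coeff_sum_sum: "coeff_sum S (\<Sum>i\<in>I. f i) = (\<Sum>i\<in>I. coeff_sum S (f i))"
  by (induction I rule: infinite_finite_induct) (auto simp: coeff_sum_add)

lemma coeff_sum_single [simp]: "coeff_sum S (Poly_Mapping.single g c) = (c when g \<in> S)"
  by (simp add: coeff_sum_def)

text \<open>Passing to the contracted ring only erases the coefficient at \<open>z\<close>, which a
  sum over a set avoiding \<open>z\<close> does not see.\<close>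

lemma coeff_sum_update_zero:
  assumes "z \<notin> S"
  shows "coeff_sum S (Poly_Mapping.update z 0 f) = coeff_sum S f"
proof -
  have "coeff_sum S (Poly_Mapping.update z 0 f) =
      (\<Sum>g\<in>Poly_Mapping.keys f. Poly_Mapping.lookup (Poly_Mapping.update z 0 f) g when g \<in> S)"
    by (intro coeff_sum_superset) (auto simp: in_keys_iff lookup_update split: if_splits)
  also have "\<dots> = coeff_sum S f"
    unfolding coeff_sum_def using assms by (intro sum.cong) (auto simp: lookup_update when_def)
  finally show ?thesis .
qed

lemma coeff_sum_mult:
  "coeff_sum S (semigroup_ring_mult m f g) =
    (\<Sum>x\<in>Poly_Mapping.keys f. \<Sum>y\<in>Poly_Mapping.keys g.
      Poly_Mapping.lookup f x * Poly_Mapping.lookup g y when m x y \<in> S)"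
  by (simp add: semigroup_ring_mult_def coeff_sum_sum)

section \<open>Monomials and commutators\<close>

text \<open>The scalar multiple \<open>c g\<close> in the contracted ring, by
  \<open>cgis_scale_cgis_of\<close>; it vanishes when \<open>g\<close> is the zero of the
  semigroup.\<close>

definition monomial ::
    "('v, 'e) pre_digraph \<Rightarrow> ('v, 'e) gis \<Rightarrow> 'c \<Rightarrow> (('v, 'e) gis \<Rightarrow>\<^sub>0 'c::{comm_ring, comm_monoid_mult})" where
  "monomial E g c = Poly_Mapping.update (gis_zero E) 0 (Poly_Mapping.single g c)"

lemma monomial_eq: "monomial E g c = (if g = gis_zero E then 0 else Poly_Mapping.single g c)"
  by (rule poly_mapping_eqI) (auto simp: monomial_def lookup_update lookup_single when_def)

lemma monomial_0 [simp]: "monomial E g 0 = 0"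
  by (simp add: monomial_eq)

lemma monomial_add: "monomial E g (c + d) = monomial E g c + monomial E g d"
  by (simp add: monomial_eq single_add)

lemma cgis_scale_cgis_of: "cgis_scale c (cgis_of E g) = monomial E g c"
  by (rule poly_mapping_eqI)
    (auto simp: monomial_def cgis_of_def lookup_cgis_scale lookup_update lookup_single when_def)

lemma cgis_carrier_0 [simp]: "0 \<in> cgis_carrier E"
  by (simp add: cgis_carrier_def)

lemma cgis_carrier_add: "f \<in> cgis_carrier E \<Longrightarrow> g \<in> cgis_carrier E \<Longrightarrow> f + g \<in> cgis_carrier E"
  using keys_add[of f g] by (auto simp: cgis_carrier_def)

lemma cgis_carrier_diff: "f \<in> cgis_carrier E \<Longrightarrow> g \<in> cgis_carrier E \<Longrightarrow> f - g \<in> cgis_carrier E"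
  using keys_diff[of f g] by (auto simp: cgis_carrier_def)

lemma cgis_carrier_sum: "(\<And>i. i \<in> I \<Longrightarrow> f i \<in> cgis_carrier E) \<Longrightarrow> (\<Sum>i\<in>I. f i) \<in> cgis_carrier E"
  by (induction I rule: infinite_finite_induct) (auto intro: cgis_carrier_add)

lemma monomial_carrier: "g \<in> gis_carrier E \<Longrightarrow> monomial E g c \<in> cgis_carrier E"
  by (auto simp: monomial_eq cgis_carrier_def)

lemma cgis_mult_single:
  "cgis_mult E (Poly_Mapping.single a c) (Poly_Mapping.single b d) = monomial E (gis_mult E a b) (c * d)"
  by (simp add: cgis_mult_def semigroup_ring_mult_def monomial_def)

context wf_digraph
begin

lemma gis_class_carrier: "w \<in> gis_words G \<Longrightarrow> gis_class G w \<in> gis_carrier G"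
  by (auto simp: gis_carrier_def gis_class_def intro: quotientI)

lemma gis_carrier_cases:
  assumes "X \<in> gis_carrier G"
  obtains w where "w \<in> gis_words G" "X = gis_class G w"
  using assms by (auto simp: gis_carrier_def gis_class_def quotient_def)

lemma gis_class_cong: "gis_cong G a b \<Longrightarrow> gis_class G a = gis_class G b"
  using gis_class_eq_iff[OF wf_digraph_axioms] gis_cong_words[OF wf_digraph_axioms] by blast

lemma gis_cong_Null_right: "set w \<subseteq> gis_gens G \<Longrightarrow> gis_cong G (w @ [Null]) [Null]"
proof (induction w)
  case (Cons g w)
  have "gis_cong G ([g] @ w @ [Null]) ([g] @ [Null])"
    using Cons by (intro gis_cong_append_left) auto
  moreover have "gis_cong G ([g] @ [Null]) [Null]"
    using Cons by (auto intro!: gis_cong.rel gis_rel.null_right)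
  ultimately show ?case by (auto elim: gis_cong.trans)
qed (auto simp: gis_words_def intro: gis_cong.refl)

lemma gis_mult_zero:
  assumes "X \<in> gis_carrier G"
  shows "gis_mult G (gis_zero G) X = gis_zero G" "gis_mult G X (gis_zero G) = gis_zero G"
proof -
  obtain w where w: "w \<in> gis_words G" "X = gis_class G w"
    using assms by (rule gis_carrier_cases)
  have Null: "[Null] \<in> gis_words G" by (simp add: gis_words_def)
  have "gis_cong G (Null # w) [Null]" "gis_cong G (w @ [Null]) [Null]"
    using w gis_cong_Null_left gis_cong_Null_right by (auto simp: gis_words_def)
  then show "gis_mult G (gis_zero G) X = gis_zero G" "gis_mult G X (gis_zero G) = gis_zero G"
    using w Null by (auto simp: gis_zero_def gis_mult_class[OF wf_digraph_axioms] intro!: gis_class_cong)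
qed

text \<open>The difference is the commutator of \<open>c X\<close> and \<open>1 Y\<close>. A zero
  factor is treated apart, because the zero of the semigroup does not occur in elements of the
  carrier.\<close>

lemma gis_mult_swap_commutator:
  assumes "X \<in> gis_carrier G" "Y \<in> gis_carrier G"
  shows "monomial G (gis_mult G X Y) c - monomial G (gis_mult G Y X) c \<in> cgis_commutators G"
proof (cases "X = gis_zero G \<or> Y = gis_zero G")
  case True
  then show ?thesis using assms by (auto simp: gis_mult_zero cgis_commutators_def)
next
  case False
  then have "Poly_Mapping.single X c \<in> cgis_carrier G"
    "Poly_Mapping.single Y (1::'c) \<in> cgis_carrier G" for c :: 'c
    using assms by (auto simp: cgis_carrier_def)
  then have "cgis_mult G (Poly_Mapping.single X c) (Poly_Mapping.single Y 1) -
      cgis_mult G (Poly_Mapping.single Y 1) (Poly_Mapping.single X c) \<in> cgis_commutators G"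
    unfolding cgis_commutators_def by (intro group_closure.base) blast
  then show ?thesis by (simp add: cgis_mult_single)
qed

text \<open>Each swap contributes one such commutator, and chains of conjugations add up.\<close>

lemma conjugate_commutator:
  "conjugate a b \<Longrightarrow> monomial G (gis_class G a) c - monomial G (gis_class G b) c \<in> cgis_commutators G"
proof (induction rule: conjugate.induct)
  case (of_cong a b)
  then show ?case by (simp add: gis_class_cong cgis_commutators_def)
next
  case (swap a b)
  then show ?case
    using gis_mult_swap_commutator[of "gis_class G a" "gis_class G b" c]
    by (simp add: gis_class_carrier gis_mult_class[OF wf_digraph_axioms])
next
  case (conj_trans a b d)
  then show ?case
    unfolding cgis_commutators_def using group_closure_add by fastforce
qed

section \<open>Functionals vanishing on commutators\<close>

definition class_set :: "(('a, 'b) nform \<Rightarrow> bool) \<Rightarrow> ('a, 'b) gis set" where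
  "class_set P = {gis_class G w |w. w \<in> gis_words G \<and> P (nf w)}"

text \<open>Congruent words have equal normal forms, so the choice of a representative does not
  matter.\<close>

lemma gis_class_in_class_set:
  assumes "w \<in> gis_words G"
  shows "gis_class G w \<in> class_set P \<longleftrightarrow> P (nf w)"
proof
  assume "gis_class G w \<in> class_set P"
  then obtain w' where "w' \<in> gis_words G" "P (nf w')" "gis_class G w = gis_class G w'"
    by (auto simp: class_set_def)
  then show "P (nf w)"
    using gis_cong_nf gis_class_eq_iff[OF wf_digraph_axioms assms] by metis
qed (use assms in \<open>auto simp: class_set_def\<close>)

lemma gis_zero_in_class_set: "gis_zero G \<in> class_set P \<longleftrightarrow> P None"
  unfolding gis_zero_def by (subst gis_class_in_class_set) (auto simp: gis_words_def nf_def)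

text \<open>Expanding both products bilinearly, the terms for \<open>X Y\<close> and
  \<open>Y X\<close> are counted together or not at all. As \<open>P None\<close> fails, the set
  avoids the zero, and the contraction in \<open>cgis_mult\<close> is invisible.\<close>

lemma coeff_sum_commutator:
  assumes inv: "\<And>g n. g \<in> gis_gens G \<Longrightarrow> nform_ok n \<Longrightarrow> P (left_act g n) = P (right_act g n)"
    and None: "\<not> P None"
    and fg: "f \<in> cgis_carrier G" "g \<in> cgis_carrier G"
  shows "coeff_sum (class_set P) (cgis_mult G f g) = coeff_sum (class_set P) (cgis_mult G g f)"
proof -
  have swap: "gis_mult G X Y \<in> class_set P \<longleftrightarrow> gis_mult G Y X \<in> class_set P"
    if XY: "X \<in> Poly_Mapping.keys f" "Y \<in> Poly_Mapping.keys g" for X Y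
  proof -
    have "X \<in> gis_carrier G" "Y \<in> gis_carrier G" using fg XY by (auto simp: cgis_carrier_def)
    then obtain a b where ab: "a \<in> gis_words G" "X = gis_class G a" "b \<in> gis_words G" "Y = gis_class G b"
      by (metis gis_carrier_cases)
    moreover from ab have "a @ b \<in> gis_words G" "b @ a \<in> gis_words G" by (auto simp: gis_words_def)
    ultimately show ?thesis
      using nf_swap_invariant[of P a b] inv
      by (simp add: gis_mult_class[OF wf_digraph_axioms] gis_class_in_class_set)
  qed
  have "coeff_sum (class_set P) (cgis_mult G f g) =
    (\<Sum>x\<in>Poly_Mapping.keys f. \<Sum>y\<in>Poly_Mapping.keys g.
      Poly_Mapping.lookup f x * Poly_Mapping.lookup g y when gis_mult G x y \<in> class_set P)"
    using None by (simp add: cgis_mult_def coeff_sum_update_zero gis_zero_in_class_set coeff_sum_mult)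
  also have "\<dots> = (\<Sum>x\<in>Poly_Mapping.keys f. \<Sum>y\<in>Poly_Mapping.keys g.
      Poly_Mapping.lookup g y * Poly_Mapping.lookup f x when gis_mult G y x \<in> class_set P)"
  proof (intro sum.cong HOL.refl)
    fix x y assume "x \<in> Poly_Mapping.keys f" "y \<in> Poly_Mapping.keys g"
    from swap[OF this] show "(Poly_Mapping.lookup f x * Poly_Mapping.lookup g y when gis_mult G x y \<in> class_set P) =
        (Poly_Mapping.lookup g y * Poly_Mapping.lookup f x when gis_mult G y x \<in> class_set P)"
      by (simp add: when_def mult.commute)
  qed
  also have "\<dots> = (\<Sum>y\<in>Poly_Mapping.keys g. \<Sum>x\<in>Poly_Mapping.keys f.
      Poly_Mapping.lookup g y * Poly_Mapping.lookup f x when gis_mult G y x \<in> class_set P)"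
    by (rule sum.swap)
  also have "\<dots> = coeff_sum (class_set P) (cgis_mult G g f)"
    using None by (simp add: cgis_mult_def coeff_sum_update_zero gis_zero_in_class_set coeff_sum_mult)
  finally show ?thesis .
qed

lemma coeff_sum_commutators:
  assumes inv: "\<And>g n. g \<in> gis_gens G \<Longrightarrow> nform_ok n \<Longrightarrow> P (left_act g n) = P (right_act g n)"
    and None: "\<not> P None"
    and "f \<in> cgis_commutators G"
  shows "coeff_sum (class_set P) f = 0"
  using assms(3) unfolding cgis_commutators_def
proof (induction rule: group_closure.induct)
  case (base s)
  then show ?case using coeff_sum_commutator[of P] inv None by (auto simp: coeff_sum_diff)
qed (simp add: coeff_sum_diff)

section \<open>Values of these functionals on closed paths and their stars\<close>

lemma path_word_in_gis_words:
  assumes "p \<in> Path G"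
  shows "path_word p \<in> gis_words G" "path_star_word p \<in> gis_words G"
  using assms by (cases p; auto simp: Path_def awalk_def gis_words_def)+

lemma gis_path_reduces_to:
  assumes "p \<in> ClPath G"
  shows "gis_path G p \<in> class_set (reduces_to q) \<longleftrightarrow> path_equiv G q p"
proof -
  obtain v es where p: "p = (v, es, v)" "p \<in> Path G" using assms by (cases p) (auto simp: ClPath_def)
  then show ?thesis
    unfolding gis_path_def by (subst gis_class_in_class_set)
      (auto simp: path_word_in_gis_words nf_path_word reduces_to_Some simp del: path_word.simps)
qed

text \<open>The normal form is \<open>([], v, es)\<close>, and the nonempty \<open>es\<close> is no
  prefix of the empty list.\<close>

lemma gis_path_star_reduces_to:
  assumes "p \<in> ClPath G - vertex_paths G"
  shows "gis_path_star G p \<notin> class_set (reduces_to q)"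
proof -
  obtain v es where p: "p = (v, es, v)" "p \<in> Path G" "es \<noteq> []"
    using assms by (cases p) (auto simp: ClPath_def vertex_paths_def Path_def awalk_Nil_iff)
  then show ?thesis
    unfolding gis_path_star_def by (subst gis_class_in_class_set)
      (auto simp: path_word_in_gis_words nf_path_star_word reduces_to_Some simp del: path_star_word.simps)
qed

lemma gis_path_star_reduces_to_star:
  assumes "p \<in> ClPath G"
  shows "gis_path_star G p \<in> class_set (\<lambda>n. reduces_to q (nform_star n)) \<longleftrightarrow> path_equiv G q p"
proof -
  obtain v es where p: "p = (v, es, v)" "p \<in> Path G" using assms by (cases p) (auto simp: ClPath_def)
  then show ?thesis
    unfolding gis_path_star_def by (subst gis_class_in_class_set)
      (auto simp: path_word_in_gis_words nf_path_star_word reduces_to_Some simp del: path_star_word.simps)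
qed

text \<open>A vertex is its own star, so the functional of a vertex \<open>q\<close> would also
  count paths of length 0. Excluding vertices from the starred family is what separates the two
  families.\<close>

lemma gis_path_reduces_to_star:
  assumes "p \<in> ClPath G" "q \<notin> vertex_paths G"
  shows "gis_path G p \<notin> class_set (\<lambda>n. reduces_to q (nform_star n))"
proof -
  obtain v es where p: "p = (v, es, v)" "p \<in> Path G" using assms by (cases p) (auto simp: ClPath_def)
  have "\<not> path_equiv G q (v, [], v)"
  proof
    assume "path_equiv G q (v, [], v)"
    then have "path_equiv G (v, [], v) q" by (rule path_equiv_sym)
    then show False using assms(2)
      by (auto simp: path_equiv_rotate_iff vertex_paths_def ClPath_def Path_def awalk_Nil_iff)
  qed
  with p show ?thesis
    unfolding gis_path_def by (subst gis_class_in_class_set)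
      (auto simp: path_word_in_gis_words nf_path_word reduces_to_Some simp del: path_word.simps)
qed

end

section \<open>Traces\<close>

context
  fixes E :: "('v, 'e) pre_digraph"
    and scale :: "'c::{comm_ring, comm_monoid_mult} \<Rightarrow> 'r::ring \<Rightarrow> 'r"
    and t :: "(('v, 'e) gis \<Rightarrow>\<^sub>0 'c) \<Rightarrow> 'r"
  assumes wf: "wf_digraph E" and trace: "linear_trace E scale t"
begin

lemma trace_add: "x \<in> cgis_carrier E \<Longrightarrow> y \<in> cgis_carrier E \<Longrightarrow> t (x + y) = t x + t y"
  using trace by (auto simp: linear_trace_def)

lemma trace_0: "t 0 = 0"
  using trace_add[of 0 0] by simp

lemma trace_diff: "x \<in> cgis_carrier E \<Longrightarrow> y \<in> cgis_carrier E \<Longrightarrow> t (x - y) = t x - t y"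
  using trace_add[of "x - y" y] by (simp add: cgis_carrier_diff algebra_simps)

lemma trace_sum: "(\<And>i. i \<in> I \<Longrightarrow> f i \<in> cgis_carrier E) \<Longrightarrow> t (\<Sum>i\<in>I. f i) = (\<Sum>i\<in>I. t (f i))"
  by (induction I rule: infinite_finite_induct) (auto simp: trace_0 trace_add cgis_carrier_sum)

lemma trace_monomial: "g \<in> gis_carrier E \<Longrightarrow> t (monomial E g c) = scale c (t (cgis_of E g))"
  using trace by (simp add: linear_trace_def cgis_of_carrier flip: cgis_scale_cgis_of)

lemma trace_commutators: "x \<in> cgis_commutators E \<Longrightarrow> x \<in> cgis_carrier E \<and> t x = 0"
  unfolding cgis_commutators_def
proof (induction rule: group_closure.induct)
  case (base s)
  then show ?case
    using trace
    by (auto simp: trace_0 trace_diff cgis_carrier_diff cgis_mult_carrier[OF wf] linear_trace_def)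
qed (simp add: trace_diff cgis_carrier_diff)

end

section \<open>Representatives of closed paths\<close>

lemma sum_nth_append:
  "(\<Sum>i<length (xs @ ys). f i ((xs @ ys) ! i)) =
    (\<Sum>i<length xs. f i (xs ! i)) + (\<Sum>j<length ys. f (length xs + j) (ys ! j))"
proof (induction ys rule: rev_induct)
  case (snoc y ys)
  then show ?case by (simp add: nth_append add.assoc flip: append_assoc)
qed (simp add: nth_append)

lemma sum_nth_distinct:
  "distinct xs \<Longrightarrow> (\<Sum>i<length xs. f (xs ! i)) = (\<Sum>x\<in>set xs. f x)"
  by (rule sum.reindex_bij_betw[OF bij_betw_nth]) auto

context wf_digraph
begin

definition path_rep :: "('a, 'b) path \<Rightarrow> ('a, 'b) path" where
  "path_rep p = (SOME q. path_equiv G p q)"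

lemma path_equiv_path_rep: "p \<in> ClPath G \<Longrightarrow> path_equiv G p (path_rep p)"
  unfolding path_rep_def by (rule someI[of _ p]) (rule path_equiv_refl)

text \<open>The choice depends on \<open>p\<close> only through the predicate
  \<open>path_equiv G p\<close>, that is, through its class.\<close>

lemma path_rep_eq:
  assumes "path_equiv G p q"
  shows "path_rep p = path_rep q"
proof -
  have "path_equiv G p = path_equiv G q"
    using path_equiv_sym[OF assms] assms by (auto intro: path_equiv_trans)
  then show ?thesis by (simp add: path_rep_def)
qed

lemma path_rep_ClPath: "p \<in> ClPath G \<Longrightarrow> path_rep p \<in> ClPath G"
  using path_equiv_path_rep by (auto simp: path_equiv_rotate_iff)

lemma path_rep_inequivalent:
  assumes "p \<in> path_rep ` ClPath G" "q \<in> path_rep ` ClPath G" "path_equiv G p q"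
  shows "p = q"
proof -
  have "path_rep r = r" if "r \<in> path_rep ` ClPath G" for r
    using that path_rep_eq[OF path_equiv_path_rep] by auto
  then show ?thesis using path_rep_eq[OF assms(3)] assms by metis
qed

lemma path_equiv_vertex:
  assumes "path_equiv G p q"
  shows "p \<in> vertex_paths G \<longleftrightarrow> q \<in> vertex_paths G"
proof -
  have "r \<in> vertex_paths G" if "path_equiv G p r" "p \<in> vertex_paths G" for p r
    using that by (auto simp: path_equiv_rotate_iff vertex_paths_def)
  then show ?thesis using assms path_equiv_sym by blast
qed

lemma path_rep_vertex: "p \<in> ClPath G \<Longrightarrow> path_rep p \<in> vertex_paths G \<longleftrightarrow> p \<in> vertex_paths G"
  using path_equiv_vertex[OF path_equiv_path_rep] by blast

text \<open>For \<open>p = x y\<close> and \<open>q = y x\<close> the words of \<open>x\<close> and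
  \<open>y\<close> are swapped; the star reverses their order.\<close>

lemma path_equiv_conjugate:
  assumes "path_equiv G p q"
  shows "conjugate (path_word p) (path_word q)" "conjugate (path_star_word p) (path_star_word q)"
proof -
  obtain x y where xy: "x \<in> Path G" "y \<in> Path G" "path_range x = path_source y"
    "p = path_comp x y" "path_range y = path_source x" "q = path_comp y x"
    using assms unfolding path_equiv_def by metis
  obtain u es v where x: "x = (u, es, v)" by (cases x) auto
  obtain fs where y: "y = (v, fs, u)" using xy x by (cases y) auto
  have *: "conjugate (path_word p) (path_word q) \<and> conjugate (path_star_word p) (path_star_word q)"
  proof (cases "es = [] \<or> fs = []")
    \<comment> \<open>A vertex factor would contribute a letter absent from the word of the
      composite; but then \<open>p = q\<close>.\<close>
    case True
    then have "p = q" using xy x y by (auto simp: path_comp_def Path_def awalk_Nil_iff)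
    moreover have "p \<in> Path G" using assms by (auto simp: path_equiv_rotate_iff ClPath_def)
    ultimately show ?thesis
      by (simp add: path_word_in_gis_words conjugate.of_cong gis_cong.refl)
  next
    case False
    then have "path_word p = path_word x @ path_word y" "path_word q = path_word y @ path_word x"
      "path_star_word p = path_star_word y @ path_star_word x"
      "path_star_word q = path_star_word x @ path_star_word y"
      using xy x y by (auto simp: path_comp_def)
    then show ?thesis
      by (simp add: conjugate.swap path_word_in_gis_words xy(1,2))
  qed
  then show "conjugate (path_word p) (path_word q)"
    "conjugate (path_star_word p) (path_star_word q)" by auto
qed

section \<open>Reduction modulo commutators to representatives of closed paths and their
  stars\<close>

definition combination ::
    "(('a, 'b) path \<Rightarrow>\<^sub>0 'c) \<Rightarrow> (('a, 'b) path \<Rightarrow>\<^sub>0 'c) \<Rightarrow> (('a, 'b) gis \<Rightarrow>\<^sub>0 'c::{comm_ring, comm_monoid_mult})"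
  where "combination c d =
    (\<Sum>q\<in>Poly_Mapping.keys c. monomial G (gis_path G q) (Poly_Mapping.lookup c q)) +
    (\<Sum>p\<in>Poly_Mapping.keys d. monomial G (gis_path_star G p) (Poly_Mapping.lookup d p))"

lemma combination_add: "combination (c + c') (d + d') = combination c d + combination c' d'"
  using setsum_keys_plus_distrib[where f = "\<lambda>q. monomial G (gis_path G q)" and p = c and q = c']
    setsum_keys_plus_distrib[where f = "\<lambda>p. monomial G (gis_path_star G p)" and p = d and q = d']
  by (simp add: combination_def monomial_add add.assoc add.left_commute)

lemma combination_0 [simp]: "combination 0 0 = 0"
  by (simp add: combination_def)

lemma combination_single:
  "combination (Poly_Mapping.single q k) 0 = monomial G (gis_path G q) k"
  "combination 0 (Poly_Mapping.single p k) = monomial G (gis_path_star G p) k"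
  by (auto simp: combination_def)

text \<open>A word is conjugate to zero, a closed path or a star; equivalent paths being conjugate,
  that path can be replaced by its representative.\<close>

lemma monomial_combination:
  assumes "X \<in> gis_carrier G"
  shows "\<exists>c d. Poly_Mapping.keys c \<subseteq> path_rep ` ClPath G \<and>
    Poly_Mapping.keys d \<subseteq> path_rep ` ClPath G - vertex_paths G \<and>
    monomial G X k - combination c d \<in> cgis_commutators G"
proof -
  obtain w where w: "w \<in> gis_words G" "X = gis_class G w"
    using assms by (rule gis_carrier_cases)
  from gis_word_conjugate[OF w(1)] consider
    (zero) "conjugate w [Null]"
    | (path) p where "p \<in> ClPath G" "conjugate w (path_word p)"
    | (star) p where "p \<in> ClPath G - vertex_paths G" "conjugate w (path_star_word p)"
    by blast
  then show ?thesis
  proof cases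
    case zero
    have "monomial G X k - combination 0 0 \<in> cgis_commutators G"
      using conjugate_commutator[OF zero, of k] w by (simp add: monomial_eq gis_zero_def)
    then show ?thesis by (intro exI[of _ 0]) auto
  next
    case path
    have "monomial G X k - combination (Poly_Mapping.single (path_rep p) k) 0 \<in> cgis_commutators G"
      using conjugate_commutator[OF conjugate.conj_trans[OF path(2)
          path_equiv_conjugate(1)[OF path_equiv_path_rep[OF path(1)]]], of k] w
      by (simp add: combination_single gis_path_def)
    then show ?thesis using path
      by (intro exI[of _ "Poly_Mapping.single (path_rep p) k"] exI[of _ 0]) auto
  next
    case star
    then have p: "p \<in> ClPath G" "p \<notin> vertex_paths G" by auto
    have "monomial G X k - combination 0 (Poly_Mapping.single (path_rep p) k) \<in> cgis_commutators G"
      using conjugate_commutator[OF conjugate.conj_trans[OF star(2)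
          path_equiv_conjugate(2)[OF path_equiv_path_rep[OF p(1)]]], of k] w
      by (simp add: combination_single gis_path_star_def)
    then show ?thesis using p
      by (intro exI[of _ 0] exI[of _ "Poly_Mapping.single (path_rep p) k"]) (auto simp: path_rep_vertex)
  qed
qed

lemma cgis_combination:
  assumes "f \<in> cgis_carrier G"
  shows "\<exists>c d. Poly_Mapping.keys c \<subseteq> path_rep ` ClPath G \<and>
    Poly_Mapping.keys d \<subseteq> path_rep ` ClPath G - vertex_paths G \<and>
    f - combination c d \<in> cgis_commutators G"
  using assms
proof (induction f rule: Poly_Mapping.update_induct)
  case const
  have "0 - combination 0 0 \<in> cgis_commutators G" by (simp add: cgis_commutators_def)
  then show ?case by (intro exI[of _ 0]) auto
next
  case (update f X k)
  then have X: "X \<in> gis_carrier G" "X \<noteq> gis_zero G" and f: "f \<in> cgis_carrier G"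
    by (auto simp: cgis_carrier_def keys_update)
  obtain c d where cd: "Poly_Mapping.keys c \<subseteq> path_rep ` ClPath G"
    "Poly_Mapping.keys d \<subseteq> path_rep ` ClPath G - vertex_paths G"
    "f - combination c d \<in> cgis_commutators G" using update.IH[OF f] by blast
  obtain c' d' where cd': "Poly_Mapping.keys c' \<subseteq> path_rep ` ClPath G"
    "Poly_Mapping.keys d' \<subseteq> path_rep ` ClPath G - vertex_paths G"
    "monomial G X k - combination c' d' \<in> cgis_commutators G" using monomial_combination[OF X(1)] by blast
  \<comment> \<open>The key \<open>X\<close> is new to \<open>f\<close> and is not the zero of the
    semigroup, so updating amounts to adding.\<close>
  have "Poly_Mapping.update X k f = f + monomial G X k"
    using update.hyps X
    by (intro poly_mapping_eqI) (auto simp: monomial_eq lookup_add lookup_update lookup_single in_keys_iff when_def)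
  then have "Poly_Mapping.update X k f - combination (c + c') (d + d') =
      (f - combination c d) + (monomial G X k - combination c' d')"
    by (simp add: combination_add)
  also have "\<dots> \<in> cgis_commutators G"
    using cd(3) cd'(3) unfolding cgis_commutators_def by (rule group_closure_add)
  finally have "Poly_Mapping.update X k f - combination (c + c') (d + d') \<in> cgis_commutators G" .
  moreover have "Poly_Mapping.keys (c + c') \<subseteq> path_rep ` ClPath G"
    using cd(1) cd'(1) keys_add[of c c'] by blast
  moreover have "Poly_Mapping.keys (d + d') \<subseteq> path_rep ` ClPath G - vertex_paths G"
    using cd(2) cd'(2) keys_add[of d d'] by blast
  ultimately show ?case by (intro exI conjI)
qed

lemma pairwise_inequivalent_reps:
  assumes "distinct ps" "set ps \<subseteq> path_rep ` ClPath G"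
  shows "pairwise_inequivalent G ps"
  unfolding pairwise_inequivalent_def
proof (intro allI impI notI)
  fix i j assume ij: "i < length ps" "j < length ps" "i \<noteq> j" "path_equiv G (ps ! i) (ps ! j)"
  then have "ps ! i = ps ! j"
    using assms(2) path_rep_inequivalent[OF _ _ ij(4)] nth_mem by blast
  then show False using ij assms(1) by (simp add: nth_eq_iff_index_eq)
qed

lemma coeff_sum_monomial:
  "gis_zero G \<notin> S \<Longrightarrow> coeff_sum S (monomial G X k) = (k when X \<in> S)"
  by (auto simp: monomial_eq when_def)

lemma sum_inequivalent:
  assumes "pairwise_inequivalent G ps" "set ps \<subseteq> ClPath G" "k < length ps"
  shows "(\<Sum>i<length ps. c i when path_equiv G (ps ! k) (ps ! i)) = (c k :: 'c::comm_monoid_add)"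
proof -
  have "path_equiv G (ps ! k) (ps ! i) \<longleftrightarrow> i = k" if "i < length ps" for i
  proof
    assume "path_equiv G (ps ! k) (ps ! i)"
    then show "i = k" using assms that by (auto simp: pairwise_inequivalent_def)
  next
    assume "i = k"
    then show "path_equiv G (ps ! k) (ps ! i)" using assms that nth_mem by (blast intro: path_equiv_refl)
  qed
  then have "(\<Sum>i<length ps. c i when path_equiv G (ps ! k) (ps ! i)) = (\<Sum>i<length ps. c i when i = k)"
    by (intro sum.cong) auto
  also have "\<dots> = c k" using assms(3) by (simp add: when_def)
  finally show ?thesis .
qed

text \<open>The functional attached to the \<open>k\<close>-th path of one family vanishes on the
  other family and on the inequivalent members of its own, so it returns the \<open>k\<close>-th
  coefficient; on commutators it is zero.\<close>

lemma commutator_coefficients: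
  fixes c :: "nat \<Rightarrow> 'c::{comm_ring, comm_monoid_mult}"
  assumes qs: "set qs \<subseteq> ClPath G" "pairwise_inequivalent G qs"
    and ps: "set ps \<subseteq> ClPath G - vertex_paths G" "pairwise_inequivalent G ps"
    and comm: "(\<Sum>i<length qs. monomial G (gis_path G (qs ! i)) (c i)) +
      (\<Sum>j<length ps. monomial G (gis_path_star G (ps ! j)) (d j)) \<in> cgis_commutators G"
  shows "\<forall>i<length qs. c i = 0" "\<forall>j<length ps. d j = 0"
proof -
  have q: "qs ! i \<in> ClPath G" if "i < length qs" for i using qs(1) that nth_mem by blast
  have p: "ps ! j \<in> ClPath G - vertex_paths G" if "j < length ps" for j using ps(1) that nth_mem by blast
  show "\<forall>i<length qs. c i = 0"
  proof (intro allI impI)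
    fix k assume k: "k < length qs"
    let ?S = "class_set (reduces_to (qs ! k))"
    have z: "gis_zero G \<notin> ?S" by (simp add: gis_zero_in_class_set)
    have "0 = coeff_sum ?S ((\<Sum>i<length qs. monomial G (gis_path G (qs ! i)) (c i)) +
      (\<Sum>j<length ps. monomial G (gis_path_star G (ps ! j)) (d j)))"
      using coeff_sum_commutators[of "reduces_to (qs ! k)", OF reduces_to_left_right_act _ comm] by simp
    also have "\<dots> = (\<Sum>i<length qs. c i when path_equiv G (qs ! k) (qs ! i))"
      using p q z by (simp add: coeff_sum_add coeff_sum_sum coeff_sum_monomial gis_path_reduces_to gis_path_star_reduces_to)
    also have "\<dots> = c k" using qs k by (intro sum_inequivalent)
    finally show "c k = 0" by simp
  qed
  show "\<forall>j<length ps. d j = 0"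
  proof (intro allI impI)
    fix k assume k: "k < length ps"
    let ?S = "class_set (\<lambda>n. reduces_to (ps ! k) (nform_star n))"
    have z: "gis_zero G \<notin> ?S" by (simp add: gis_zero_in_class_set)
    have "0 = coeff_sum ?S ((\<Sum>i<length qs. monomial G (gis_path G (qs ! i)) (c i)) +
      (\<Sum>j<length ps. monomial G (gis_path_star G (ps ! j)) (d j)))"
      using coeff_sum_commutators[of "\<lambda>n. reduces_to (ps ! k) (nform_star n)",
          OF reduces_to_star_left_right_act _ comm] by simp
    also have "\<dots> = (\<Sum>i<length ps. d i when path_equiv G (ps ! k) (ps ! i))"
      \<comment> \<open>\<open>p[OF k]\<close> supplies that \<open>ps ! k\<close> is not a vertex,
        so that the unstarred terms vanish.\<close>
      using p q z p[OF k]
      by (simp add: coeff_sum_add coeff_sum_sum coeff_sum_monomial gis_path_reduces_to_star gis_path_star_reduces_to_star)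
    also have "\<dots> = d k" using ps k by (intro sum_inequivalent) auto
    finally show "d k = 0" by simp
  qed
qed

end

section \<open>Minimality of a trace and linear independence of its values\<close>

theorem corollary21:
  fixes scale :: "'c::{comm_ring, comm_monoid_mult} \<Rightarrow> 'r::ring \<Rightarrow> 'r"
    and E :: "('v, 'e) pre_digraph"
    and t :: "(('v, 'e) gis \<Rightarrow>\<^sub>0 'c) \<Rightarrow> 'r"
  assumes "algebra_over scale"
    and "wf_digraph E"
    and "linear_trace E scale t"
  shows "minimal_trace E t \<longleftrightarrow>
    (\<forall>qs ps. set qs \<subseteq> ClPath E \<longrightarrow> set ps \<subseteq> ClPath E - vertex_paths E \<longrightarrow>
       pairwise_inequivalent E qs \<longrightarrow> pairwise_inequivalent E ps \<longrightarrow>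
       lin_indep_family scale
         (map (\<lambda>q. t (cgis_of E (gis_path E q))) qs @
          map (\<lambda>p. t (cgis_of E (gis_path_star E p))) ps))"
    (is "_ \<longleftrightarrow> ?indep")
proof -
  interpret wf_digraph E by fact
  note tr = assms(2,3)
  have carrier: "gis_path E p \<in> gis_carrier E" "gis_path_star E p \<in> gis_carrier E" if "p \<in> ClPath E" for p
    using that gis_path_carrier[of p E] by (auto simp: ClPath_def)
  show ?thesis
  proof
    assume min: "minimal_trace E t"
    show ?indep
    proof (intro allI impI)
      fix qs ps :: "('v, 'e) path list"
      assume qs: "set qs \<subseteq> ClPath E" "pairwise_inequivalent E qs"
        and ps: "set ps \<subseteq> ClPath E - vertex_paths E" "pairwise_inequivalent E ps"
      let ?qs = "map (\<lambda>q. t (cgis_of E (gis_path E q))) qs"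
      let ?ps = "map (\<lambda>p. t (cgis_of E (gis_path_star E p))) ps"
      show "lin_indep_family scale (?qs @ ?ps)"
        unfolding lin_indep_family_def
      proof (intro allI impI)
        fix c :: "nat \<Rightarrow> 'c" and k
        assume sum0: "(\<Sum>i<length (?qs @ ?ps). scale (c i) ((?qs @ ?ps) ! i)) = 0"
          and k: "k < length (?qs @ ?ps)"
        \<comment> \<open>The starred paths occupy the positions from \<open>length qs\<close> on in
          the joint family.\<close>
        let ?d = "\<lambda>j. c (length qs + j)"
        let ?a = "\<Sum>i<length qs. monomial E (gis_path E (qs ! i)) (c i)"
        let ?b = "\<Sum>j<length ps. monomial E (gis_path_star E (ps ! j)) (?d j)"
        have q: "qs ! i \<in> ClPath E" if "i < length qs" for i using qs(1) that nth_mem by blast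
        have p: "ps ! j \<in> ClPath E" if "j < length ps" for j using ps(1) that nth_mem by blast
        have ab: "?a \<in> cgis_carrier E" "?b \<in> cgis_carrier E"
          by (auto intro!: cgis_carrier_sum monomial_carrier carrier q p)
        have "t (?a + ?b) = (\<Sum>i<length qs. scale (c i) (t (cgis_of E (gis_path E (qs ! i))))) +
            (\<Sum>j<length ps. scale (?d j) (t (cgis_of E (gis_path_star E (ps ! j)))))"
        proof -
          have "t ?a = (\<Sum>i<length qs. t (monomial E (gis_path E (qs ! i)) (c i)))"
            by (intro trace_sum[OF tr]) (auto intro!: monomial_carrier carrier q)
          moreover have "t ?b = (\<Sum>j<length ps. t (monomial E (gis_path_star E (ps ! j)) (?d j)))"
            by (intro trace_sum[OF tr]) (auto intro!: monomial_carrier carrier p)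
          ultimately show ?thesis
            by (simp add: trace_add[OF tr ab] trace_monomial[OF tr] carrier p q)
        qed
        also have "\<dots> = 0"
          using sum0 unfolding sum_nth_append[of "\<lambda>i. scale (c i)" ?qs ?ps] by simp
        \<comment> \<open>The linear relation says that this element has trace zero, so minimality
          applies to it.\<close>
        finally have "?a + ?b \<in> cgis_commutators E"
          using min cgis_carrier_add[OF ab] by (auto simp: minimal_trace_def)
        from commutator_coefficients[OF qs ps this] k show "c k = 0"
          by (cases "k < length qs") (auto dest: spec[of _ "k - length qs"])
      qed
    qed
  next
    assume indep: ?indep
    show "minimal_trace E t"
      unfolding minimal_trace_def
    proof (intro ballI impI)
      fix x assume x: "x \<in> cgis_carrier E" "t x = 0"
      obtain c d where cd: "Poly_Mapping.keys c \<subseteq> path_rep ` ClPath E"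
        "Poly_Mapping.keys d \<subseteq> path_rep ` ClPath E - vertex_paths E"
        "x - combination c d \<in> cgis_commutators E" using cgis_combination[OF x(1)] by blast
      \<comment> \<open>Independence concerns lists, so the supports are enumerated without
        repetition; distinct representatives are inequivalent.\<close>
      obtain qs where qs: "set qs = Poly_Mapping.keys c" "distinct qs"
        using finite_distinct_list[OF finite_keys[of c]] by auto
      obtain ps where ps: "set ps = Poly_Mapping.keys d" "distinct ps"
        using finite_distinct_list[OF finite_keys[of d]] by auto
      let ?qs = "map (\<lambda>q. t (cgis_of E (gis_path E q))) qs"
      let ?ps = "map (\<lambda>p. t (cgis_of E (gis_path_star E p))) ps"
      have cl: "Poly_Mapping.keys c \<subseteq> ClPath E" "Poly_Mapping.keys d \<subseteq> ClPath E - vertex_paths E"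
        using cd path_rep_ClPath by blast+
      have "lin_indep_family scale (?qs @ ?ps)"
      proof (rule indep[rule_format])
        show "pairwise_inequivalent E qs" "pairwise_inequivalent E ps"
          using qs ps cd by (auto intro!: pairwise_inequivalent_reps)
      qed (use qs ps cl in auto)
      then have ind: "\<And>k. (\<Sum>i<length (?qs @ ?ps). scale (k i) ((?qs @ ?ps) ! i)) = 0 \<Longrightarrow>
          \<forall>i<length (?qs @ ?ps). k i = 0"
        unfolding lin_indep_family_def by blast
      let ?k = "\<lambda>i. if i < length qs then Poly_Mapping.lookup c (qs ! i)
        else Poly_Mapping.lookup d (ps ! (i - length qs))"
      have mem: "monomial E (gis_path E q) k \<in> cgis_carrier E" if "q \<in> Poly_Mapping.keys c" for q and k :: 'c
        using that cl carrier by (blast intro: monomial_carrier)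
      have mem': "monomial E (gis_path_star E p) k \<in> cgis_carrier E" if "p \<in> Poly_Mapping.keys d" for p and k :: 'c
        using that cl carrier by (blast intro: monomial_carrier)
      have com: "combination c d \<in> cgis_carrier E"
        unfolding combination_def using mem mem' by (intro cgis_carrier_add cgis_carrier_sum)
      have "(\<Sum>i<length (?qs @ ?ps). scale (?k i) ((?qs @ ?ps) ! i)) =
          (\<Sum>i<length qs. scale (Poly_Mapping.lookup c (qs ! i)) (t (cgis_of E (gis_path E (qs ! i))))) +
          (\<Sum>i<length ps. scale (Poly_Mapping.lookup d (ps ! i)) (t (cgis_of E (gis_path_star E (ps ! i)))))"
        unfolding sum_nth_append[of "\<lambda>i. scale (?k i)" ?qs ?ps] by simp
      also have "\<dots> = (\<Sum>q\<in>Poly_Mapping.keys c. scale (Poly_Mapping.lookup c q) (t (cgis_of E (gis_path E q)))) +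
          (\<Sum>p\<in>Poly_Mapping.keys d. scale (Poly_Mapping.lookup d p) (t (cgis_of E (gis_path_star E p))))"
        using sum_nth_distinct[OF qs(2), of "\<lambda>q. scale (Poly_Mapping.lookup c q) (t (cgis_of E (gis_path E q)))"]
          sum_nth_distinct[OF ps(2), of "\<lambda>p. scale (Poly_Mapping.lookup d p) (t (cgis_of E (gis_path_star E p)))"]
        by (simp add: qs ps)
      also have "\<dots> = t (combination c d)"
      proof -
        have "scale k (t (cgis_of E (gis_path E q))) = t (monomial E (gis_path E q) k)"
          if "q \<in> Poly_Mapping.keys c" for q k
          using that cl by (subst trace_monomial[OF tr]) (auto intro!: carrier)
        moreover have "scale k (t (cgis_of E (gis_path_star E p))) = t (monomial E (gis_path_star E p) k)"
          if "p \<in> Poly_Mapping.keys d" for p k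
          using that cl by (subst trace_monomial[OF tr]) (auto intro!: carrier)
        ultimately show ?thesis
          unfolding combination_def using mem mem'
          by (simp add: trace_add[OF tr] trace_sum[OF tr] cgis_carrier_sum)
      qed
      \<comment> \<open>The trace vanishes on \<open>x\<close> by assumption and on
        \<open>x - combination c d\<close> because that is a sum of commutators.\<close>
      also have "\<dots> = t x - t (x - combination c d)"
        using x com by (simp add: trace_diff[OF tr])
      also have "\<dots> = 0"
        using trace_commutators[OF tr cd(3)] x by simp
      finally have 0: "\<forall>i<length (?qs @ ?ps). ?k i = 0" by (rule ind)
      \<comment> \<open>A key has a nonzero coefficient, whereas independence makes all coefficients
        of the reduced form zero.\<close>
      have "Poly_Mapping.keys c = {}"
      proof (rule ccontr)
        assume "Poly_Mapping.keys c \<noteq> {}"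
        then obtain i where "i < length qs" "qs ! i \<in> Poly_Mapping.keys c"
          using qs(1) by (metis ex_in_conv in_set_conv_nth)
        with 0 show False by (auto simp: in_keys_iff dest!: spec[of _ i])
      qed
      moreover have "Poly_Mapping.keys d = {}"
      proof (rule ccontr)
        assume "Poly_Mapping.keys d \<noteq> {}"
        then obtain i where "i < length ps" "ps ! i \<in> Poly_Mapping.keys d"
          using ps(1) by (metis ex_in_conv in_set_conv_nth)
        with 0 show False by (auto simp: in_keys_iff dest!: spec[of _ "length qs + i"])
      qed
      ultimately have "combination c d = 0" by (simp add: combination_def)
      then show "x \<in> cgis_commutators E" using cd(3) by simp
    qed
  qed
qed

end
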